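(* Every irreducible $\mathbb{C}U$-module is (isomorphic to) a constituent of some orbit module $\mathbb{C}\mathcal{O}_A$ with $[A]\in\hat V$ main separated.
   Context: Let $q$ be a power of an odd prime $p$, $n$ a positive integer, and fix a Lie type $\mathfrak B_n$, $\mathfrak C_n$ or $\mathfrak D_n$. Put $N=2n+1$ in type $\mathfrak B_n$, $N=2n$ in types $\mathfrak C_n,\mathfrak D_n$; $\tilde n=n+1$ in type $\mathfrak B_n$, $\tilde n=n$ otherwise; $\bar i=N+1-i$ for $1\le i\le N$. Let $P^\circ=\{(i,j):1\le i<j<\bar i\}$, $\Gamma=\{(i,\bar i):1\le i<\bar i\}$; $P=P^\circ$ in types $\mathfrak B_n,\mathfrak D_n$ and $P=P^\circ\cup\Gamma$ in type $\mathfrak C_n$. $V$ is the space of $N\times N$-matrices over $\mathbb F_q$ whose support $\operatorname{supp}$ (set of positions of nonzero entries) lies in $P$; $\pi$ is the map from $N\times N$-matrices onto $V$ replacing entries outside $P$ by zero. $\widetilde U$ is the group of upper unitriangular $N\times N$-matrices over $\mathbb F_q$, $\tilde x_{ij}(\alpha)=1+\alpha e_{ij}$ with $e_{ij}$ the matrix units. For $(i,j)\in P$, $\alpha\in\mathbb F_q$ define $x_{ij}(\alpha)$: in type $\mathfrak D_n$, and in type $\mathfrak B_n$ if $j\ne n+1$: $1+\alpha e_{ij}-\alpha e_{\bar j\,\bar i}$; in type $\mathfrak B_n$, $j=n+1$: $1+\alpha e_{i,n+1}-\alpha e_{n+1,\bar i}-\frac12\alpha^2e_{i\bar i}$; in type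 $\mathfrak C_n$: $1+\alpha e_{ij}-\alpha e_{\bar j\,\bar i}$ if $j\le n$, $1+\alpha e_{ij}+\alpha e_{\bar j\,\bar i}$ if $n<j<\bar i$, and $1+\alpha e_{i\bar i}$ if $j=\bar i$. $X_{ij}=\{x_{ij}(\alpha):\alpha\in\mathbb F_q\}$ and $U\le\widetilde U$ is the group generated by all $X_{ij}$, $(i,j)\in P$ (a $p$-Sylow subgroup of the finite classical group of the given type). The restriction of $\pi$ to $U$ is a bijection $U\to V$. Fix a nontrivial linear character $\theta:(\mathbb F_q,+)\to\mathbb C^*$ and put $\kappa(A,B)=\operatorname{tr}(A^tB)$. For $A\in V$ let $[A]$ be the linear character $B\mapsto\theta(\kappa(-A,B))$ of $(V,+)$; $\hat V=\{[A]:A\in V\}$. For $g\in\widetilde U$ (with $g^{-t}$ the inverse transpose) put $[A].g=[\pi(Ag^{-t})]$ and $[A]g=\theta(\kappa(-A,\pi(g^{-1})))\,[A].g$; the latter makes $\mathbb C\hat V$ a right $\mathbb C\widetilde U$-module (isomorphic to the right regular module upon restriction to $U$). $\mathcal O_A=\{[A].u:u\in U\}$, and the orbit module $\mathbb C\mathcal O_A$ is its $\mathbb C$-span, a $\mathbb CU$-submodule of $\mathbb C\hat V$. For $A\in V$, $\operatorname{main}(A)$ is the set of $(i,j)\in P$ such that $A_{ij}$ is the rightmost nonzero entry of row $i$ of $A$; $\operatorname{r.main}(A)=\{(i,j)\in\operatorname{main}(A):j>\tilde n\}$. For $(i,j)\in P$ set $\mathcal A(i,j)=\{(\bar j,a)\in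 P^\circ\}$ (all positions of row $\bar j$ in $P^\circ$), $\mathcal L(i,j)=\{(a,j)\in P^\circ:a>i\}$. $\operatorname{Limb}^\circ(A)=\bigcup_{(i,j)\in\operatorname{main}(A)}\mathcal A(i,j)\cup\mathcal L(i,j)$; $\operatorname{Limb}(A)=\operatorname{Limb}^\circ(A)$ in types $\mathfrak B_n,\mathfrak D_n$ and $\operatorname{Limb}(A)=\operatorname{Limb}^\circ(A)\cup\{(\bar j,j)\in\Gamma: \exists i,\ (i,j)\in\operatorname{r.main}(A)\cap P^\circ\}$ in type $\mathfrak C_n$. $[A]$ is called main separated if $\operatorname{Limb}(A)\cap\operatorname{main}(A)=\emptyset$. *)

theory Defs
  imports
    Jordan_Normal_Form.Matrix
    "HOL-Algebra.Generated_Groups"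
    "HOL-Library.Poly_Mapping"
    "HOL-Library.Cardinality"
    "HOL-Computational_Algebra.Primes"
    Complex_Main
begin

text \<open>Positions \<open>(i, j)\<close> are 1-based as in the mathematical text, whereas the entries of the
  library type \<open>'a mat\<close> are 0-based; \<open>ent\<close>, \<open>mat_unit\<close> and \<open>proj\<close> translate between the two.\<close>

datatype lie_type = Type_B | Type_C | Type_D

definition Ndim :: "lie_type \<Rightarrow> nat \<Rightarrow> nat" where
  "Ndim ty n = (if ty = Type_B then 2 * n + 1 else 2 * n)"

definition ntilde :: "lie_type \<Rightarrow> nat \<Rightarrow> nat" where
  "ntilde ty n = (if ty = Type_B then n + 1 else n)"

definition bar :: "lie_type \<Rightarrow> nat \<Rightarrow> nat \<Rightarrow> nat" where
  "bar ty n i = Ndim ty n + 1 - i"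

definition Pcirc :: "lie_type \<Rightarrow> nat \<Rightarrow> (nat \<times> nat) set" where
  "Pcirc ty n = {(i, j). 1 \<le> i \<and> i < j \<and> j < bar ty n i}"

definition Gam :: "lie_type \<Rightarrow> nat \<Rightarrow> (nat \<times> nat) set" where
  "Gam ty n = {(i, bar ty n i) | i. 1 \<le> i \<and> i < bar ty n i}"

definition Ppos :: "lie_type \<Rightarrow> nat \<Rightarrow> (nat \<times> nat) set" where
  "Ppos ty n = (if ty = Type_C then Pcirc ty n \<union> Gam ty n else Pcirc ty n)"

definition ent :: "'a mat \<Rightarrow> nat \<Rightarrow> nat \<Rightarrow> 'a" where
  "ent A i j = A $$ (i - 1, j - 1)"

definition mat_unit :: "nat \<Rightarrow> nat \<Rightarrow> nat \<Rightarrow> 'a::{zero,one} mat" where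
  "mat_unit N i j = mat N N (\<lambda>(r, c). if r + 1 = i \<and> c + 1 = j then 1 else 0)"

definition supp :: "'a::zero mat \<Rightarrow> (nat \<times> nat) set" where
  "supp A = {(i, j). 1 \<le> i \<and> i \<le> dim_row A \<and> 1 \<le> j \<and> j \<le> dim_col A \<and> ent A i j \<noteq> 0}"

definition Vspace :: "lie_type \<Rightarrow> nat \<Rightarrow> 'a::zero mat set" where
  "Vspace ty n = {A \<in> carrier_mat (Ndim ty n) (Ndim ty n). supp A \<subseteq> Ppos ty n}"

definition proj :: "lie_type \<Rightarrow> nat \<Rightarrow> 'a::zero mat \<Rightarrow> 'a mat" where
  "proj ty n A = mat (Ndim ty n) (Ndim ty n)
     (\<lambda>(r, c). if (r + 1, c + 1) \<in> Ppos ty n then A $$ (r, c) else 0)"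

definition Utilde :: "lie_type \<Rightarrow> nat \<Rightarrow> 'a::field mat monoid" where
  "Utilde ty n =
    \<lparr>carrier = {g \<in> carrier_mat (Ndim ty n) (Ndim ty n).
        upper_triangular g \<and> (\<forall>i < Ndim ty n. g $$ (i, i) = 1)},
     mult = (*), one = 1\<^sub>m (Ndim ty n)\<rparr>"

definition xroot :: "lie_type \<Rightarrow> nat \<Rightarrow> nat \<Rightarrow> nat \<Rightarrow> 'a::field \<Rightarrow> 'a mat" where
  "xroot ty n i j \<alpha> =
    (let N = Ndim ty n; b = bar ty n; e = mat_unit N in
     case ty of
       Type_D \<Rightarrow> 1\<^sub>m N + \<alpha> \<cdot>\<^sub>m e i j - \<alpha> \<cdot>\<^sub>m e (b j) (b i)
     | Type_B \<Rightarrow>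
         if j \<noteq> n + 1 then 1\<^sub>m N + \<alpha> \<cdot>\<^sub>m e i j - \<alpha> \<cdot>\<^sub>m e (b j) (b i)
         else 1\<^sub>m N + \<alpha> \<cdot>\<^sub>m e i (n + 1) - \<alpha> \<cdot>\<^sub>m e (n + 1) (b i) - (\<alpha>\<^sup>2 / 2) \<cdot>\<^sub>m e i (b i)
     | Type_C \<Rightarrow>
         if j \<le> n then 1\<^sub>m N + \<alpha> \<cdot>\<^sub>m e i j - \<alpha> \<cdot>\<^sub>m e (b j) (b i)
         else if j < b i then 1\<^sub>m N + \<alpha> \<cdot>\<^sub>m e i j + \<alpha> \<cdot>\<^sub>m e (b j) (b i)
         else 1\<^sub>m N + \<alpha> \<cdot>\<^sub>m e i (b i))"

definition Xroot :: "lie_type \<Rightarrow> nat \<Rightarrow> nat \<Rightarrow> nat \<Rightarrow> 'a::field mat set" where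
  "Xroot ty n i j = range (xroot ty n i j)"

definition Ugrp :: "lie_type \<Rightarrow> nat \<Rightarrow> 'a::field mat monoid" where
  "Ugrp ty n = subgroup_generated (Utilde ty n) (\<Union>(i, j)\<in>Ppos ty n. Xroot ty n i j)"

text \<open>A right module over the group algebra of \<open>G\<close> over the complex numbers is given by a complex
  vector space \<open>W\<close> (a subspace of an ambient one) with a linear right action of \<open>G\<close>.  No
  dimension bound is imposed.\<close>

locale cg_module = vector_space scale
  for scale :: "complex \<Rightarrow> 'v::ab_group_add \<Rightarrow> 'v" +
  fixes G :: "('g, 'r) monoid_scheme" (structure)
    and W :: "'v set"
    and act :: "'v \<Rightarrow> 'g \<Rightarrow> 'v"
  assumes W_subspace: "subspace W"
    and act_closed: "v \<in> W \<Longrightarrow> g \<in> carrier G \<Longrightarrow> act v g \<in> W"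
    and act_add: "v \<in> W \<Longrightarrow> w \<in> W \<Longrightarrow> g \<in> carrier G \<Longrightarrow> act (v + w) g = act v g + act w g"
    and act_scale: "v \<in> W \<Longrightarrow> g \<in> carrier G \<Longrightarrow> act (scale c v) g = scale c (act v g)"
    and act_one: "v \<in> W \<Longrightarrow> act v \<one> = v"
    and act_mult: "v \<in> W \<Longrightarrow> g \<in> carrier G \<Longrightarrow> h \<in> carrier G
                    \<Longrightarrow> act v (g \<otimes> h) = act (act v g) h"

definition cg_submodule ::
  "(complex \<Rightarrow> 'v::ab_group_add \<Rightarrow> 'v) \<Rightarrow> ('g, 'r) monoid_scheme \<Rightarrow> 'v set \<Rightarrow> ('v \<Rightarrow> 'g \<Rightarrow> 'v)
    \<Rightarrow> 'v set \<Rightarrow> bool" where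
  "cg_submodule s G W act S \<longleftrightarrow>
     S \<subseteq> W \<and> module.subspace s S \<and> (\<forall>v\<in>S. \<forall>g\<in>carrier G. act v g \<in> S)"

definition cg_irreducible ::
  "(complex \<Rightarrow> 'v::ab_group_add \<Rightarrow> 'v) \<Rightarrow> ('g, 'r) monoid_scheme \<Rightarrow> 'v set \<Rightarrow> ('v \<Rightarrow> 'g \<Rightarrow> 'v)
    \<Rightarrow> bool" where
  "cg_irreducible s G W act \<longleftrightarrow>
     cg_module s G W act \<and> W \<noteq> {0} \<and>
     (\<forall>S. cg_submodule s G W act S \<longrightarrow> S = {0} \<or> S = W)"

definition cg_isomorphic ::
  "('g, 'r) monoid_scheme
    \<Rightarrow> (complex \<Rightarrow> 'v::ab_group_add \<Rightarrow> 'v) \<Rightarrow> 'v set \<Rightarrow> ('v \<Rightarrow> 'g \<Rightarrow> 'v)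
    \<Rightarrow> (complex \<Rightarrow> 'w::ab_group_add \<Rightarrow> 'w) \<Rightarrow> 'w set \<Rightarrow> ('w \<Rightarrow> 'g \<Rightarrow> 'w) \<Rightarrow> bool" where
  "cg_isomorphic G s W act s' W' act' \<longleftrightarrow>
     (\<exists>f. bij_betw f W W' \<and>
          (\<forall>v\<in>W. \<forall>w\<in>W. f (v + w) = f v + f w) \<and>
          (\<forall>c. \<forall>v\<in>W. f (s c v) = s' c (f v)) \<and>
          (\<forall>v\<in>W. \<forall>g\<in>carrier G. f (act v g) = act' (f v) g))"

text \<open>Constituents are taken in the sense of semisimple modules: \<open>M\<close> is isomorphic to a direct
  summand of \<open>W\<close>.  For irreducible \<open>M\<close> this implies that \<open>M\<close> is (isomorphic to) a submodule and
  a composition factor of \<open>W\<close>.\<close>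

definition cg_constituent ::
  "('g, 'r) monoid_scheme
    \<Rightarrow> (complex \<Rightarrow> 'v::ab_group_add \<Rightarrow> 'v) \<Rightarrow> 'v set \<Rightarrow> ('v \<Rightarrow> 'g \<Rightarrow> 'v)
    \<Rightarrow> (complex \<Rightarrow> 'w::ab_group_add \<Rightarrow> 'w) \<Rightarrow> 'w set \<Rightarrow> ('w \<Rightarrow> 'g \<Rightarrow> 'w) \<Rightarrow> bool" where
  "cg_constituent G sM M actM s W act \<longleftrightarrow>
     (\<exists>S T. cg_submodule s G W act S \<and> cg_submodule s G W act T \<and>
            S \<inter> T = {0} \<and> W = {x + y | x y. x \<in> S \<and> y \<in> T} \<and>
            cg_isomorphic G sM M actM s S act)"

definition add_character :: "('a::ab_group_add \<Rightarrow> complex) \<Rightarrow> bool" where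
  "add_character \<theta> \<longleftrightarrow> (\<forall>x. \<theta> x \<noteq> 0) \<and> (\<forall>x y. \<theta> (x + y) = \<theta> x * \<theta> y)"

definition mtrace :: "'a::comm_monoid_add mat \<Rightarrow> 'a" where
  "mtrace A = (\<Sum>i<dim_row A. A $$ (i, i))"

definition kap :: "'a::comm_semiring_0 mat \<Rightarrow> 'a mat \<Rightarrow> 'a" where
  "kap A B = mtrace (transpose_mat A * B)"

text \<open>The character \<open>[A]\<close>, as an (extensional) function on \<open>V\<close>.\<close>

definition lchar ::
  "lie_type \<Rightarrow> nat \<Rightarrow> ('a::field \<Rightarrow> complex) \<Rightarrow> 'a mat \<Rightarrow> ('a mat \<Rightarrow> complex)" where
  "lchar ty n \<theta> A = (\<lambda>B\<in>Vspace ty n. \<theta> (kap (- A) B))"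

text \<open>\<open>[A].g\<close> is the character of the matrix \<open>dot_mat ty n A g\<close>.\<close>

definition dot_mat :: "lie_type \<Rightarrow> nat \<Rightarrow> 'a::field mat \<Rightarrow> 'a mat \<Rightarrow> 'a mat" where
  "dot_mat ty n A g = proj ty n (A * transpose_mat (inv\<^bsub>Utilde ty n\<^esub> g))"

text \<open>The space with basis \<open>{[A] | A \<in> V}\<close> is realised inside the free complex vector space on
  functions \<open>'a mat \<Rightarrow> complex\<close>; the basis vector attached to the character \<open>[A]\<close> is
  \<open>Poly_Mapping.single (lchar ty n \<theta> A) 1\<close>.  As \<open>A \<mapsto> [A]\<close> is injective on \<open>V\<close> for nontrivial
  \<open>\<theta>\<close>, \<open>hat_act\<close> is the linear extension of \<open>[A] \<mapsto> \<theta> (kap (- A) (proj (g\<^sup>-\<^sup>1))) [A].g\<close>.\<close>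

definition hat_scale :: "complex \<Rightarrow> ('b \<Rightarrow>\<^sub>0 complex) \<Rightarrow> ('b \<Rightarrow>\<^sub>0 complex)" where
  "hat_scale c f = Poly_Mapping.map ((*) c) f"

lemma lookup_hat_scale: "Poly_Mapping.lookup (hat_scale c f) k = c * Poly_Mapping.lookup f k"
  by (simp add: hat_scale_def Poly_Mapping.map.rep_eq when_def)

lemma vector_space_hat_scale: "vector_space hat_scale"
  by unfold_locales
    (auto intro!: poly_mapping_eqI simp: lookup_hat_scale lookup_add algebra_simps)

definition hat_act ::
  "lie_type \<Rightarrow> nat \<Rightarrow> ('a::{field,finite} \<Rightarrow> complex)
    \<Rightarrow> (('a mat \<Rightarrow> complex) \<Rightarrow>\<^sub>0 complex) \<Rightarrow> 'a mat \<Rightarrow> (('a mat \<Rightarrow> complex) \<Rightarrow>\<^sub>0 complex)" where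
  "hat_act ty n \<theta> f g =
     (\<Sum>A\<in>Vspace ty n.
        hat_scale (Poly_Mapping.lookup f (lchar ty n \<theta> A))
          (hat_scale (\<theta> (kap (- A) (proj ty n (inv\<^bsub>Utilde ty n\<^esub> g))))
            (Poly_Mapping.single (lchar ty n \<theta> (dot_mat ty n A g)) 1)))"

definition orbit ::
  "lie_type \<Rightarrow> nat \<Rightarrow> ('a::field \<Rightarrow> complex) \<Rightarrow> 'a mat \<Rightarrow> ('a mat \<Rightarrow> complex) set" where
  "orbit ty n \<theta> A = {lchar ty n \<theta> (dot_mat ty n A u) | u. u \<in> carrier (Ugrp ty n)}"

definition orbit_module ::
  "lie_type \<Rightarrow> nat \<Rightarrow> ('a::field \<Rightarrow> complex) \<Rightarrow> 'a mat
    \<Rightarrow> (('a mat \<Rightarrow> complex) \<Rightarrow>\<^sub>0 complex) set" where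
  "orbit_module ty n \<theta> A =
     module.span hat_scale ((\<lambda>\<chi>. Poly_Mapping.single \<chi> 1) ` orbit ty n \<theta> A)"

definition main_pos :: "lie_type \<Rightarrow> nat \<Rightarrow> 'a::zero mat \<Rightarrow> (nat \<times> nat) set" where
  "main_pos ty n A =
     {(i, j) \<in> Ppos ty n. ent A i j \<noteq> 0 \<and> (\<forall>k. j < k \<and> k \<le> Ndim ty n \<longrightarrow> ent A i k = 0)}"

definition r_main :: "lie_type \<Rightarrow> nat \<Rightarrow> 'a::zero mat \<Rightarrow> (nat \<times> nat) set" where
  "r_main ty n A = {(i, j) \<in> main_pos ty n A. j > ntilde ty n}"

definition arm :: "lie_type \<Rightarrow> nat \<Rightarrow> nat \<times> nat \<Rightarrow> (nat \<times> nat) set" where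
  "arm ty n = (\<lambda>(i, j). {(bar ty n j, a) | a. (bar ty n j, a) \<in> Pcirc ty n})"

definition leg :: "lie_type \<Rightarrow> nat \<Rightarrow> nat \<times> nat \<Rightarrow> (nat \<times> nat) set" where
  "leg ty n = (\<lambda>(i, j). {(a, j) | a. (a, j) \<in> Pcirc ty n \<and> a > i})"

definition Limb_circ :: "lie_type \<Rightarrow> nat \<Rightarrow> 'a::zero mat \<Rightarrow> (nat \<times> nat) set" where
  "Limb_circ ty n A = (\<Union>p\<in>main_pos ty n A. arm ty n p \<union> leg ty n p)"

definition Limb :: "lie_type \<Rightarrow> nat \<Rightarrow> 'a::zero mat \<Rightarrow> (nat \<times> nat) set" where
  "Limb ty n A =
     (if ty = Type_C
      then Limb_circ ty n A \<union>
        {(bar ty n j, j) | j. (bar ty n j, j) \<in> Gam ty n \<and>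
                              (\<exists>i. (i, j) \<in> r_main ty n A \<inter> Pcirc ty n)}
      else Limb_circ ty n A)"

definition main_separated :: "lie_type \<Rightarrow> nat \<Rightarrow> 'a::zero mat \<Rightarrow> bool" where
  "main_separated ty n A \<longleftrightarrow> Limb ty n A \<inter> main_pos ty n A = {}"

end

theory Submission
  imports Defs "Jordan_Normal_Form.Determinant"
begin

text \<open>Since every \<open>g\<close> maps \<open>[A]\<close> to a multiple of \<open>[A].g\<close>, the orbit module of \<open>A\<close> is induced from the
  linear character by which the stabiliser of \<open>[A]\<close> in \<open>U\<close> acts on \<open>[A]\<close>.  An irreducible module
  \<open>M\<close> is therefore a constituent as soon as it contains a nonzero vector on which the stabiliser
  acts by that character (\<open>stab_eigenvector_imp_constituent\<close>).  It remains to find a main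
  separated \<open>A\<close> for which \<open>M\<close> contains such an eigenvector.

  Both the stabiliser and its character can be read off from the rows of \<open>A\<close>: an element \<open>g\<close>
  stabilises \<open>[A]\<close> iff \<open>\<pi> (A g\<^sup>t) = A\<close>, and then its eigenvalue is \<open>\<theta> (kap A g)\<close>.  Three facts
  about eigenvectors carry the proof.

  First, \<open>exists_stab_eigenvector\<close> is a Fourier transform in the rows below the \<open>k\<close>-th one: if the
  upper rows are prescribed, and a vector behaves correctly under the stabilising elements that
  are trivial in the lower rows, then the lower rows can be completed to a matrix that has an
  eigenvector.  With \<open>k = 0\<close> this shows that \<open>M\<close> has an eigenvector for some \<open>A\<close>, because an element
  of \<open>U\<close> with zero projection to \<open>V\<close> is the identity.

  Second, if two rows end in the same column, then subtracting a multiple of the upper one from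
  the lower one changes neither the stabiliser nor its character (\<open>leg_reduction\<close>).

  Third, if \<open>(i, j)\<close> is a main position and row \<open>bar j\<close> ends before column \<open>j\<close>, then row \<open>bar j\<close>
  can be replaced by zero at the expense of the rows below it (\<open>arm_reduction\<close>).  This is where
  the classical form enters: it transports the equations which row \<open>i\<close> imposes on column \<open>j\<close>
  of a stabilising element to its row \<open>bar j\<close>.

  Main separation fails only when one of the two moves applies to some row \<open>a\<close>.  Either move
  makes row \<open>a\<close> end further to the left and keeps the rows above \<open>a\<close>, so the conflicts can be
  removed row by row from top to bottom (\<open>exists_separated_eigenvector\<close>).\<close>

section \<open>Matrices through their 1-based entries\<close>

lemma ent_mult:
  assumes "A \<in> carrier_mat N N" "B \<in> carrier_mat N N" "i \<in> {1..N}" "j \<in> {1..N}"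
  shows "ent (A * B) i j = (\<Sum>k=1..N. ent A i k * ent B k j)"
proof -
  have "ent (A * B) i j = (\<Sum>k<N. A $$ (i - 1, k) * B $$ (k, j - 1))"
    using assms by (auto simp: ent_def scalar_prod_def atLeast0LessThan intro!: sum.cong)
  then show ?thesis by (simp add: ent_def sum.atLeast1_atMost_eq)
qed

lemma ent_transpose:
  assumes "A \<in> carrier_mat N N" "i \<in> {1..N}" "j \<in> {1..N}"
  shows "ent (transpose_mat A) i j = ent A j i"
  using assms by (auto simp: ent_def)

lemma ent_mult_transpose:
  assumes "A \<in> carrier_mat N N" "B \<in> carrier_mat N N" "i \<in> {1..N}" "j \<in> {1..N}"
  shows "ent (A * transpose_mat B) i j = (\<Sum>k=1..N. ent A i k * ent B j k)"
  using assms by (subst ent_mult[of _ N]) (auto intro!: sum.cong simp: ent_transpose[of B N])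

lemma mat_eqI_ent:
  assumes "A \<in> carrier_mat N N" "B \<in> carrier_mat N N"
    and "\<And>i j. i \<in> {1..N} \<Longrightarrow> j \<in> {1..N} \<Longrightarrow> ent A i j = ent B i j"
  shows "A = B"
proof (rule eq_matI)
  fix i j assume "i < dim_row B" "j < dim_col B"
  then show "A $$ (i, j) = B $$ (i, j)"
    using assms(3)[of "Suc i" "Suc j"] assms(1,2) by (auto simp: ent_def)
qed (use assms in auto)

lemma kap_ent:
  assumes "A \<in> carrier_mat N N" "B \<in> carrier_mat N N"
  shows "kap A B = (\<Sum>i=1..N. \<Sum>j=1..N. ent A i j * ent B i j)"
proof -
  have "kap A B = (\<Sum>j<N. \<Sum>i<N. A $$ (i, j) * B $$ (i, j))"
    using assms by (auto simp: kap_def mtrace_def scalar_prod_def atLeast0LessThan intro!: sum.cong)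
  also have "\<dots> = (\<Sum>i<N. \<Sum>j<N. A $$ (i, j) * B $$ (i, j))"
    by (rule sum.swap)
  finally show ?thesis by (simp add: ent_def sum.atLeast1_atMost_eq)
qed

lemma ent_add:
  assumes "A \<in> carrier_mat N N" "B \<in> carrier_mat N N" "i \<in> {1..N}" "j \<in> {1..N}"
  shows "ent (A + B) i j = ent A i j + ent B i j"
  using assms by (auto simp: ent_def)

lemma ent_uminus:
  assumes "A \<in> carrier_mat N N" "i \<in> {1..N}" "j \<in> {1..N}"
  shows "ent (- A) i j = - ent A i j"
  using assms by (auto simp: ent_def)

lemma kap_uminus:
  fixes A B :: "'a::comm_ring mat"
  assumes "A \<in> carrier_mat N N" "B \<in> carrier_mat N N"
  shows "kap (- A) B = - kap A B"
  using assms by (simp add: kap_ent[of _ N] ent_uminus[of A N] sum_negf)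

lemma kap_add_left:
  fixes A B :: "'a::comm_ring mat"
  assumes "A \<in> carrier_mat N N" "A' \<in> carrier_mat N N" "B \<in> carrier_mat N N"
  shows "kap (A + A') B = kap A B + kap A' B"
  using assms by (simp add: kap_ent[of _ N] ent_add[of A N] sum.distrib algebra_simps)

definition mat_of :: "nat \<Rightarrow> (nat \<Rightarrow> nat \<Rightarrow> 'a) \<Rightarrow> 'a mat" where
  "mat_of N f = mat N N (\<lambda>(r, c). f (r + 1) (c + 1))"

lemma mat_of_carrier [simp]: "mat_of N f \<in> carrier_mat N N"
  by (simp add: mat_of_def)

lemma ent_mat_of [simp]:
  "1 \<le> i \<Longrightarrow> i \<le> N \<Longrightarrow> 1 \<le> j \<Longrightarrow> j \<le> N \<Longrightarrow> ent (mat_of N f) i j = f i j"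
  by (auto simp: mat_of_def ent_def)

lemma finite_carrier_mat: "finite (carrier_mat N N :: 'a::finite mat set)"
proof (rule finite_subset)
  show "carrier_mat N N \<subseteq> (\<lambda>f. mat N N f :: 'a mat) ` (PiE ({..<N} \<times> {..<N}) (\<lambda>_. UNIV))"
  proof
    fix A :: "'a mat" assume A: "A \<in> carrier_mat N N"
    show "A \<in> (\<lambda>f. mat N N f) ` (PiE ({..<N} \<times> {..<N}) (\<lambda>_. UNIV))"
      by (rule image_eqI[of _ _ "restrict (\<lambda>p. A $$ p) ({..<N} \<times> {..<N})"])
         (use A in \<open>auto intro!: eq_matI\<close>)
  qed
qed (auto intro!: finite_imageI finite_PiE)

section \<open>The space V and the action of unitriangular matrices on it\<close>

lemma Ppos_bounds:
  assumes "(r, c) \<in> Ppos ty n"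
  shows "1 \<le> r" "r < c" "c \<le> bar ty n r" "r \<le> Ndim ty n" "c \<le> Ndim ty n" "r \<in> {1..Ndim ty n}" "c \<in> {1..Ndim ty n}"
  using assms by (auto simp: Ppos_def Pcirc_def Gam_def bar_def split: if_splits)

lemma Ppos_left:
  assumes "(r, l) \<in> Ppos ty n" "r < m" "m \<le> l"
  shows "(r, m) \<in> Ppos ty n"
  using assms by (auto simp: Ppos_def Pcirc_def Gam_def bar_def split: if_splits)

lemma Vspace_ent_0:
  assumes "A \<in> Vspace ty n" "(i, j) \<notin> Ppos ty n" "i \<in> {1..Ndim ty n}" "j \<in> {1..Ndim ty n}"
  shows "ent A i j = 0"
  using assms by (auto simp: Vspace_def supp_def)

lemma Vspace_carrier: "A \<in> Vspace ty n \<Longrightarrow> A \<in> carrier_mat (Ndim ty n) (Ndim ty n)"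
  by (simp add: Vspace_def)

lemma VspaceI:
  assumes "A \<in> carrier_mat (Ndim ty n) (Ndim ty n)"
    and "\<And>i j. i \<in> {1..Ndim ty n} \<Longrightarrow> j \<in> {1..Ndim ty n} \<Longrightarrow> ent A i j \<noteq> 0 \<Longrightarrow> (i, j) \<in> Ppos ty n"
  shows "A \<in> Vspace ty n"
  using assms by (auto simp: Vspace_def supp_def)

lemma finite_Vspace: "finite (Vspace ty n :: 'a::{zero,finite} mat set)"
  by (rule finite_subset[OF _ finite_carrier_mat]) (auto simp: Vspace_def)

lemma proj_carrier: "proj ty n A \<in> carrier_mat (Ndim ty n) (Ndim ty n)"
  by (simp add: proj_def)

lemma ent_proj:
  assumes "i \<in> {1..Ndim ty n}" "j \<in> {1..Ndim ty n}"
  shows "ent (proj ty n A) i j = (if (i, j) \<in> Ppos ty n then ent A i j else 0)"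
  using assms by (auto simp: proj_def ent_def)

lemma proj_in_Vspace: "proj ty n A \<in> Vspace ty n"
  by (rule VspaceI[OF proj_carrier]) (simp add: ent_proj split: if_splits)

lemma kap_proj:
  fixes A B :: "'a::comm_ring mat"
  assumes "A \<in> Vspace ty n" "B \<in> carrier_mat (Ndim ty n) (Ndim ty n)"
  shows "kap A (proj ty n B) = kap A B"
  unfolding kap_ent[OF Vspace_carrier[OF assms(1)] assms(2)]
    kap_ent[OF Vspace_carrier[OF assms(1)] proj_carrier]
  by (intro sum.cong refl) (auto simp: ent_proj Vspace_ent_0[OF assms(1)])

lemma Utilde_carrier_iff:
  "g \<in> carrier (Utilde ty n) \<longleftrightarrow> g \<in> carrier_mat (Ndim ty n) (Ndim ty n) \<and>
     (\<forall>i\<in>{1..Ndim ty n}. ent g i i = 1) \<and> (\<forall>i j. 1 \<le> j \<and> j < i \<and> i \<le> Ndim ty n \<longrightarrow> ent g i j = 0)"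
  (is "?L \<longleftrightarrow> ?R")
proof
  assume ?L then show ?R by (auto simp: Utilde_def ent_def)
next
  assume R: ?R
  have "g $$ (i, i) = 1" if "i < Ndim ty n" for i
    using R that by (auto simp: ent_def dest!: bspec[of _ _ "Suc i"])
  moreover have "g $$ (i, j) = 0" if "i < Ndim ty n" "j < i" for i j
  proof -
    have "ent g (Suc i) (Suc j) = 0" using R that by auto
    then show ?thesis by (simp add: ent_def)
  qed
  ultimately show ?L using R by (auto simp: Utilde_def)
qed

lemma Utilde_carrier_mat: "g \<in> carrier (Utilde ty n) \<Longrightarrow> g \<in> carrier_mat (Ndim ty n) (Ndim ty n)"
  by (simp add: Utilde_carrier_iff)

lemma Utilde_diag: "g \<in> carrier (Utilde ty n) \<Longrightarrow> 1 \<le> i \<Longrightarrow> i \<le> Ndim ty n \<Longrightarrow> ent g i i = 1"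
  by (simp add: Utilde_carrier_iff)

lemma Utilde_lower:
  "g \<in> carrier (Utilde ty n) \<Longrightarrow> 1 \<le> j \<Longrightarrow> j < i \<Longrightarrow> i \<le> Ndim ty n \<Longrightarrow> ent g i j = 0"
  by (simp add: Utilde_carrier_iff)

lemma mult_Utilde [simp]: "mult (Utilde ty n) = (*)"
  and one_Utilde [simp]: "\<one>\<^bsub>Utilde ty n\<^esub> = 1\<^sub>m (Ndim ty n)"
  by (simp_all add: Utilde_def)

lemma Utilde_mult_closed:
  assumes "g \<in> carrier (Utilde ty n)" "h \<in> carrier (Utilde ty n)"
  shows "g * h \<in> carrier (Utilde ty n)"
proof -
  let ?N = "Ndim ty n"
  note gc = Utilde_carrier_mat[OF assms(1)] and hc = Utilde_carrier_mat[OF assms(2)]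
  have "ent (g * h) i j = (if i = j then 1 else 0)" if "1 \<le> j" "j \<le> i" "i \<le> ?N" for i j
  proof -
    have "ent (g * h) i j = (\<Sum>k=1..?N. ent g i k * ent h k j)"
      using that by (intro ent_mult[OF gc hc]) auto
    also have "\<dots> = (\<Sum>k=1..?N. if k = i then (if i = j then 1 else 0) else 0)"
    proof (intro sum.cong refl)
      fix k assume k: "k \<in> {1..?N}"
      consider "k < i" | "k = i" | "k > i" by linarith
      then show "ent g i k * ent h k j = (if k = i then (if i = j then 1 else 0) else 0)"
        by cases (use k that assms in \<open>auto simp: Utilde_lower Utilde_diag\<close>)
    qed
    also have "\<dots> = (if i = j then 1 else 0)" using that by simp
    finally show ?thesis .
  qed
  then show ?thesis using gc hc by (auto simp: Utilde_carrier_iff)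
qed

text \<open>Finiteness spares the explicit inverse of a unitriangular matrix: left multiplication by \<open>g\<close>
  is injective, because \<open>det g = 1\<close>, hence it permutes the finite set of unitriangular matrices
  and reaches \<open>1\<close>.\<close>
lemma group_Utilde: "group (Utilde ty n :: 'a::{field,finite} mat monoid)"
proof (rule groupI)
  let ?N = "Ndim ty n"
  let ?C = "carrier (Utilde ty n :: 'a mat monoid)"
  show one: "\<one>\<^bsub>Utilde ty n\<^esub> \<in> ?C" by (auto simp: Utilde_def)
  fix g assume g: "g \<in> ?C"
  note gc = Utilde_carrier_mat[OF g]
  have "det g = prod_list (diag_mat g)"
    by (rule det_upper_triangular[OF _ gc]) (use g in \<open>simp add: Utilde_def\<close>)
  also have "diag_mat g = map (\<lambda>_. 1) [0..<?N]"
    using g by (auto simp: Utilde_def diag_mat_def)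
  finally have "det g = 1" by (simp add: map_replicate_const)
  then obtain k where k: "k \<in> carrier_mat ?N ?N" "k * g = 1\<^sub>m ?N"
    using det_non_zero_imp_unit[OF gc, of undefined] by (auto simp: Units_def ring_mat_def)
  have "inj_on (\<lambda>h. g * h) ?C"
  proof (rule inj_onI)
    fix x y assume xy: "x \<in> ?C" "y \<in> ?C" "g * x = g * y"
    then have "k * (g * x) = k * (g * y)" by simp
    then show "x = y"
      using k xy(1,2)[THEN Utilde_carrier_mat] gc by (simp flip: assoc_mult_mat[of k ?N ?N g ?N])
  qed
  moreover have "finite ?C"
    by (rule finite_subset[OF _ finite_carrier_mat]) (auto dest: Utilde_carrier_mat)
  ultimately have "(\<lambda>h. g * h) ` ?C = ?C"
    by (intro endo_inj_surj) (auto intro: Utilde_mult_closed[OF g])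
  then have "1\<^sub>m ?N \<in> (\<lambda>h. g * h) ` ?C"
    using one by simp
  then obtain h where h: "h \<in> ?C" "g * h = 1\<^sub>m ?N"
    by (metis imageE)
  have "h * g = 1\<^sub>m ?N"
    by (rule mat_mult_left_right_inverse[OF gc Utilde_carrier_mat[OF h(1)] h(2)])
  then show "\<exists>h\<in>?C. h \<otimes>\<^bsub>Utilde ty n\<^esub> g = \<one>\<^bsub>Utilde ty n\<^esub>"
    using h(1) by auto
  show "\<one>\<^bsub>Utilde ty n\<^esub> \<otimes>\<^bsub>Utilde ty n\<^esub> g = g" using gc by simp
next
  fix x y z :: "'a mat" assume "x \<in> carrier (Utilde ty n)" "y \<in> carrier (Utilde ty n)" "z \<in> carrier (Utilde ty n)"
  then show "x \<otimes>\<^bsub>Utilde ty n\<^esub> y \<otimes>\<^bsub>Utilde ty n\<^esub> z = x \<otimes>\<^bsub>Utilde ty n\<^esub> (y \<otimes>\<^bsub>Utilde ty n\<^esub> z)"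
    by (auto dest!: Utilde_carrier_mat intro!: assoc_mult_mat)
qed (auto intro: Utilde_mult_closed)

text \<open>Working with \<open>A g\<^sup>t\<close> instead of \<open>A g\<^sup>-\<^sup>t\<close> avoids inverses.  A matrix is stabilised by \<open>g\<close> under
  one of the two actions iff it is under the other, so nothing is lost for stabilisers.\<close>
definition tdot :: "lie_type \<Rightarrow> nat \<Rightarrow> 'a::field mat \<Rightarrow> 'a mat \<Rightarrow> 'a mat" where
  "tdot ty n A g = proj ty n (A * transpose_mat g)"

lemma tdot_in_Vspace: "tdot ty n A g \<in> Vspace ty n"
  by (simp add: tdot_def proj_in_Vspace)

lemma ent_tdot:
  assumes "A \<in> Vspace ty n" "g \<in> carrier (Utilde ty n)" "(r, k) \<in> Ppos ty n"
  shows "ent (tdot ty n A g) r k = (\<Sum>l=1..Ndim ty n. ent A r l * ent g k l)"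
  using assms Ppos_bounds[OF assms(3)]
  by (simp add: tdot_def ent_proj ent_mult_transpose[OF Vspace_carrier Utilde_carrier_mat])

text \<open>Row \<open>r\<close> of \<open>A\<close> vanishes to the right of \<open>P\<close> and \<open>g\<^sup>t\<close> moves entries only to the left, so nothing
  nonzero enters the part of row \<open>r\<close> beyond \<open>P\<close>.  This is what makes the truncation \<open>\<pi>\<close> compatible
  with products.\<close>
lemma row_out_of_Ppos:
  assumes A: "A \<in> Vspace ty n" and g: "g \<in> carrier (Utilde ty n)"
    and "1 \<le> r" "r < m" "m \<le> Ndim ty n" "(r, m) \<notin> Ppos ty n"
  shows "(\<Sum>l=1..Ndim ty n. ent A r l * ent g m l) = 0"
proof (intro sum.neutral ballI)
  fix l assume l: "l \<in> {1..Ndim ty n}"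
  show "ent A r l * ent g m l = 0"
  proof (cases "l < m")
    case True
    then show ?thesis using Utilde_lower[OF g] l assms by auto
  next
    case False
    then have "(r, l) \<notin> Ppos ty n" using Ppos_left[of r l ty n m] assms by auto
    then show ?thesis using Vspace_ent_0[OF A] l assms by auto
  qed
qed

lemma tdot_mult:
  assumes A: "A \<in> Vspace ty n" and g: "g \<in> carrier (Utilde ty n)" and h: "h \<in> carrier (Utilde ty n)"
  shows "tdot ty n A (g * h) = tdot ty n (tdot ty n A h) g"
proof (rule mat_eqI_ent)
  let ?N = "Ndim ty n"
  fix r k assume rk: "r \<in> {1..?N}" "k \<in> {1..?N}"
  show "ent (tdot ty n A (g * h)) r k = ent (tdot ty n (tdot ty n A h) g) r k"
  proof (cases "(r, k) \<in> Ppos ty n")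
    case True
    note b = Ppos_bounds[OF True]
    have "ent (tdot ty n A (g * h)) r k = (\<Sum>l=1..?N. ent A r l * (\<Sum>m=1..?N. ent g k m * ent h m l))"
      unfolding ent_tdot[OF A Utilde_mult_closed[OF g h] True]
      using rk by (intro sum.cong refl) (simp add: ent_mult[OF Utilde_carrier_mat[OF g] Utilde_carrier_mat[OF h]])
    also have "\<dots> = (\<Sum>l=1..?N. \<Sum>m=1..?N. ent A r l * ent h m l * ent g k m)"
      by (simp add: sum_distrib_left mult_ac)
    also have "\<dots> = (\<Sum>m=1..?N. (\<Sum>l=1..?N. ent A r l * ent h m l) * ent g k m)"
      by (subst sum.swap) (simp add: sum_distrib_right)
    also have "\<dots> = (\<Sum>m=1..?N. ent (tdot ty n A h) r m * ent g k m)"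
    proof (intro sum.cong refl)
      fix m assume m: "m \<in> {1..?N}"
      show "(\<Sum>l=1..?N. ent A r l * ent h m l) * ent g k m = ent (tdot ty n A h) r m * ent g k m"
      proof (cases "m < k")
        case True then show ?thesis using Utilde_lower[OF g] m rk by auto
      next
        case False
        then have "r < m" using b by auto
        show ?thesis
        proof (cases "(r, m) \<in> Ppos ty n")
          case True then show ?thesis by (simp add: ent_tdot[OF A h])
        next
          case False
          then show ?thesis
            using row_out_of_Ppos[OF A h _ \<open>r < m\<close> _ False]
              Vspace_ent_0[OF tdot_in_Vspace[of ty n A h] False] m rk by simp
        qed
      qed
    qed
    also have "\<dots> = ent (tdot ty n (tdot ty n A h) g) r k"
      by (simp add: ent_tdot[OF tdot_in_Vspace g True])
    finally show ?thesis .
  qed (use rk in \<open>simp add: Vspace_ent_0[OF tdot_in_Vspace]\<close>)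
qed (simp_all add: Vspace_carrier tdot_in_Vspace)

text \<open>The cocycle identity behind everything: it makes the span of the characters \<open>[A]\<close> a module, and
  it makes \<open>g \<mapsto> \<theta> (kap A g)\<close> multiplicative on the stabiliser of \<open>A\<close>.  The second summand comes
  from the diagonal ones of \<open>g\<close>.\<close>
lemma kap_mult:
  assumes A: "A \<in> Vspace ty n" and g: "g \<in> carrier (Utilde ty n)" and h: "h \<in> carrier (Utilde ty n)"
  shows "kap A (g * h) = kap (tdot ty n A h) g + kap A h"
proof -
  let ?N = "Ndim ty n"
  note c = Vspace_carrier[OF A] Utilde_carrier_mat[OF g] Utilde_carrier_mat[OF h]
    Vspace_carrier[OF tdot_in_Vspace]
  have row: "(\<Sum>l=1..?N. ent A r l * ent (g * h) r l) =
      (\<Sum>m=1..?N. ent (tdot ty n A h) r m * ent g r m) + (\<Sum>l=1..?N. ent A r l * ent h r l)"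
    if r: "r \<in> {1..?N}" for r
  proof -
    have "(\<Sum>l=1..?N. ent A r l * ent (g * h) r l) =
        (\<Sum>l=1..?N. ent A r l * (\<Sum>m=1..?N. ent g r m * ent h m l))"
      using r by (intro sum.cong refl) (simp add: ent_mult[OF c(2,3)])
    also have "\<dots> = (\<Sum>l=1..?N. \<Sum>m=1..?N. ent A r l * ent h m l * ent g r m)"
      by (simp add: sum_distrib_left mult_ac)
    also have "\<dots> = (\<Sum>m=1..?N. (\<Sum>l=1..?N. ent A r l * ent h m l) * ent g r m)"
      by (subst sum.swap) (simp add: sum_distrib_right)
    also have "\<dots> = (\<Sum>m=1..?N. ent (tdot ty n A h) r m * ent g r m +
        (if m = r then \<Sum>l=1..?N. ent A r l * ent h r l else 0))"
    proof (intro sum.cong refl)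
      fix m assume m: "m \<in> {1..?N}"
      consider "m < r" | "m = r" | "m > r" "(r, m) \<in> Ppos ty n" | "m > r" "(r, m) \<notin> Ppos ty n" by linarith
      then show "(\<Sum>l=1..?N. ent A r l * ent h m l) * ent g r m = ent (tdot ty n A h) r m * ent g r m +
        (if m = r then \<Sum>l=1..?N. ent A r l * ent h r l else 0)"
      proof cases
        case 1 then show ?thesis using Utilde_lower[OF g] m r by auto
      next
        case 2
        have "(r, r) \<notin> Ppos ty n" using Ppos_bounds(2) by blast
        then show ?thesis using 2 m r Utilde_diag[OF g] by (simp add: Vspace_ent_0[OF tdot_in_Vspace])
      next
        case 3 then show ?thesis by (simp add: ent_tdot[OF A h])
      next
        case 4 then show ?thesis
          using row_out_of_Ppos[OF A h _ 4(1) _ 4(2)] Vspace_ent_0[OF tdot_in_Vspace[of ty n A h] 4(2)] m r by simp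
      qed
    qed
    also have "\<dots> = (\<Sum>m=1..?N. ent (tdot ty n A h) r m * ent g r m) + (\<Sum>l=1..?N. ent A r l * ent h r l)"
      using r by (simp add: sum.distrib)
    finally show ?thesis .
  qed
  show ?thesis
    unfolding kap_ent[OF c(1) mult_carrier_mat[OF c(2,3)]] kap_ent[OF c(4,2)] kap_ent[OF c(1,3)]
    using row by (simp add: sum.distrib)
qed

lemma tdot_one:
  assumes "A \<in> Vspace ty n"
  shows "tdot ty n A (1\<^sub>m (Ndim ty n)) = A"
proof -
  have "A * transpose_mat (1\<^sub>m (Ndim ty n)) = A"
    using Vspace_carrier[OF assms] by simp
  then show ?thesis
    by (intro mat_eqI_ent[of _ "Ndim ty n"])
       (auto simp: tdot_def ent_proj Vspace_carrier proj_carrier Vspace_ent_0[OF assms] assms)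
qed

lemma kap_one: 
  assumes "A \<in> Vspace ty n" shows "kap A (1\<^sub>m (Ndim ty n)) = 0"
proof -
  have "ent A i j * ent (1\<^sub>m (Ndim ty n)) i j = 0" if "i \<in> {1..Ndim ty n}" "j \<in> {1..Ndim ty n}" for i j
  proof (cases "i = j")
    case True
    then have "(i, j) \<notin> Ppos ty n" using Ppos_bounds(2) by blast
    then show ?thesis using Vspace_ent_0[OF assms] that by simp
  qed (use that in \<open>auto simp: ent_def\<close>)
  then show ?thesis by (simp add: kap_ent[OF Vspace_carrier[OF assms], of "1\<^sub>m (Ndim ty n)"])
qed

section \<open>The classical form and its isometries\<close>

lemma bar_le: "1 \<le> m \<Longrightarrow> bar ty n m \<le> Ndim ty n"
  and bar_ge: "m \<le> Ndim ty n \<Longrightarrow> 1 \<le> bar ty n m"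
  and bar_bar [simp]: "m \<le> Ndim ty n \<Longrightarrow> bar ty n (bar ty n m) = m"
  by (auto simp: bar_def)

lemma bar_eq_iff: "l \<le> Ndim ty n \<Longrightarrow> m \<le> Ndim ty n \<Longrightarrow> bar ty n l = bar ty n m \<longleftrightarrow> l = m"
  by (auto simp: bar_def)

text \<open>The antidiagonal entries of the form that the classical group preserves: symmetric in types B
  and D, alternating in type C.\<close>
definition form_sign :: "lie_type \<Rightarrow> nat \<Rightarrow> nat \<Rightarrow> 'a::field" where
  "form_sign ty n m = (if ty = Type_C \<and> n < m then - 1 else 1)"

definition form_mat :: "lie_type \<Rightarrow> nat \<Rightarrow> 'a::field mat" where
  "form_mat ty n = mat_of (Ndim ty n) (\<lambda>i j. if j = bar ty n i then form_sign ty n i else 0)"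

definition isometry :: "lie_type \<Rightarrow> nat \<Rightarrow> 'a::field mat \<Rightarrow> bool" where
  "isometry ty n g \<longleftrightarrow> g \<in> carrier_mat (Ndim ty n) (Ndim ty n) \<and>
     g * form_mat ty n * transpose_mat g = form_mat ty n"

lemma form_mat_carrier [simp]: "form_mat ty n \<in> carrier_mat (Ndim ty n) (Ndim ty n)"
  by (simp add: form_mat_def)

lemma dim_form_mat [simp]:
  "dim_row (form_mat ty n) = Ndim ty n" "dim_col (form_mat ty n) = Ndim ty n"
  by (simp_all add: form_mat_def mat_of_def)

lemma ent_conj_form:
  assumes g: "g \<in> carrier_mat (Ndim ty n) (Ndim ty n)"
    and r: "r \<in> {1..Ndim ty n}" and s: "s \<in> {1..Ndim ty n}"
  shows "ent (g * form_mat ty n * transpose_mat g) r s =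
    (\<Sum>m=1..Ndim ty n. form_sign ty n (bar ty n m) * ent g r (bar ty n m) * ent g s m)"
proof -
  have "ent (g * form_mat ty n) r m = form_sign ty n (bar ty n m) * ent g r (bar ty n m)"
    if m: "m \<in> {1..Ndim ty n}" for m
  proof -
    have "ent (g * form_mat ty n) r m =
        (\<Sum>k=1..Ndim ty n. ent g r k * ent (form_mat ty n) k m)"
      using g r m by (intro ent_mult) auto
    also have "\<dots> = (\<Sum>k=1..Ndim ty n. if k = bar ty n m then form_sign ty n (bar ty n m) * ent g r (bar ty n m) else 0)"
      by (intro sum.cong refl) (use m in \<open>auto simp: form_mat_def\<close>)
    also have "\<dots> = form_sign ty n (bar ty n m) * ent g r (bar ty n m)"
      using m bar_le[of m ty n] bar_ge[of m ty n] by simp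
    finally show ?thesis .
  qed
  then show ?thesis
    by (simp add: ent_mult_transpose[OF mult_carrier_mat[OF g form_mat_carrier] g r s])
qed

lemma isometry_rows:
  assumes "isometry ty n g" "r \<in> {1..Ndim ty n}" "s \<in> {1..Ndim ty n}"
  shows "(\<Sum>m=1..Ndim ty n. form_sign ty n (bar ty n m) * ent g r (bar ty n m) * ent g s m) =
     (if s = bar ty n r then form_sign ty n r else 0)"
  using assms ent_conj_form[of g ty n r s] by (auto simp: isometry_def form_mat_def)

lemma isometry_mult:
  assumes "isometry ty n g" "isometry ty n h"
  shows "isometry ty n (g * h)"
proof -
  let ?N = "Ndim ty n" and ?J = "form_mat ty n :: 'a mat"
  have c: "g \<in> carrier_mat ?N ?N" "h \<in> carrier_mat ?N ?N" and
    gh: "g * ?J * transpose_mat g = ?J" "h * ?J * transpose_mat h = ?J"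
    using assms by (auto simp: isometry_def)
  have "g * h * ?J * transpose_mat (g * h) = g * (h * ?J * transpose_mat h) * transpose_mat g"
    using c by (simp add: transpose_mult[of g ?N ?N h ?N] assoc_mult_mat[of _ ?N ?N _ ?N _ ?N]
      mult_carrier_mat[of _ ?N ?N _ ?N])
  then show ?thesis using c gh by (auto simp: isometry_def)
qed

lemma isometry_left_inverse:
  assumes "isometry ty n g" "h \<in> carrier_mat (Ndim ty n) (Ndim ty n)" "h * g = 1\<^sub>m (Ndim ty n)"
  shows "isometry ty n h"
proof -
  let ?N = "Ndim ty n" and ?J = "form_mat ty n :: 'a mat"
  have c: "g \<in> carrier_mat ?N ?N" "h \<in> carrier_mat ?N ?N" and
    g: "g * ?J * transpose_mat g = ?J"
    using assms by (auto simp: isometry_def)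
  have "h * ?J * transpose_mat h = h * (g * ?J * transpose_mat g) * transpose_mat h"
    by (simp add: g)
  also have "\<dots> = (h * g) * ?J * transpose_mat (h * g)"
    using c by (simp add: transpose_mult[of h ?N ?N g ?N] assoc_mult_mat[of _ ?N ?N _ ?N _ ?N]
      mult_carrier_mat[of _ ?N ?N _ ?N])
  also have "\<dots> = ?J" by (simp add: assms(3))
  finally show ?thesis using c by (auto simp: isometry_def)
qed

lemma isometry_one: "isometry ty n (1\<^sub>m (Ndim ty n))"
  by (simp add: isometry_def)

lemma ent_mat_unit:
  "1 \<le> r \<Longrightarrow> r \<le> N \<Longrightarrow> 1 \<le> c \<Longrightarrow> c \<le> N \<Longrightarrow> ent (mat_unit N i j) r c = (if r = i \<and> c = j then 1 else 0)"
  by (auto simp: mat_unit_def ent_def)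

lemma dim_mat_unit [simp]: "dim_row (mat_unit N i j) = N" "dim_col (mat_unit N i j) = N"
  by (simp_all add: mat_unit_def)

lemma ent_one:
  "1 \<le> r \<Longrightarrow> r \<le> N \<Longrightarrow> 1 \<le> c \<Longrightarrow> c \<le> N \<Longrightarrow> ent (1\<^sub>m N) r c = (if c = r then 1 else 0)"
  by (auto simp: ent_def)

text \<open>The entry pattern common to the root elements of all three types.  The long roots of type C are
  covered by \<open>\<alpha> = \<beta> = 0\<close>, and \<open>\<gamma>\<close> carries in type B the quadratic term that appears when \<open>j\<close> is the
  middle index.\<close>
lemma isometry_root_shape:
  fixes x :: "'a::field mat" and \<alpha> \<beta> \<gamma> :: 'a
  assumes x: "x \<in> carrier_mat (Ndim ty n) (Ndim ty n)"
    and ent: "\<And>r c. 1 \<le> r \<Longrightarrow> r \<le> Ndim ty n \<Longrightarrow> 1 \<le> c \<Longrightarrow> c \<le> Ndim ty n \<Longrightarrow> ent x r c =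
       (if c = r then 1 else 0) + (if c = j then if r = i then \<alpha> else 0 else 0)
       + (if c = bar ty n i then if r = bar ty n j then \<beta> else 0 else 0)
       + (if c = bar ty n i then if r = i then \<gamma> else 0 else 0)"
    and i: "1 \<le> i" "i < bar ty n i"
    and j: "1 \<le> j" "j \<le> Ndim ty n" "(\<alpha> = 0 \<and> \<beta> = 0) \<or> (i < j \<and> j < bar ty n i)"
    and ab: "\<beta> = - form_sign ty n j * \<alpha>"
    and c: "\<gamma> + form_sign ty n (bar ty n i) * \<gamma> + (if j = bar ty n j then \<alpha>\<^sup>2 else 0) = 0"
    and odd_C: "j = bar ty n j \<Longrightarrow> ty \<noteq> Type_C"
  shows "isometry ty n x"
proof -
  let ?N = "Ndim ty n" and ?b = "bar ty n" and ?e = "form_sign ty n :: nat \<Rightarrow> 'a"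
  have iN: "i \<le> ?N" "?b i \<le> ?N" "1 \<le> ?b i" "?b j \<le> ?N" "1 \<le> ?b j" "i \<noteq> ?b i" using i j by (auto simp: bar_def)
  have ei: "?e i = 1" "?e (?b i) = (if ty = Type_C then -1 else 1)"
    using i by (auto simp: form_sign_def bar_def Ndim_def)
  have eb: "?e (?b m) = ?e (?b i) * ?e m" if "1 \<le> m" "m \<le> ?N" for m
    using that i by (auto simp: form_sign_def bar_def Ndim_def)
  have ee: "?e m * ?e m = 1" for m by (simp add: form_sign_def)
  have "ent (x * form_mat ty n * transpose_mat x) r s = ent (form_mat ty n) r s"
    if r: "r \<in> {1..?N}" and s: "s \<in> {1..?N}" for r s
  proof -
    define F where "F m = ?e (?b m) * ent x r (?b m)" for m
    have "ent (x * form_mat ty n * transpose_mat x) r s = (\<Sum>m=1..?N. F m * ent x s m)"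
      unfolding ent_conj_form[OF x r s] F_def by simp
    also have "\<dots> = (\<Sum>m=1..?N. (if m = s then F s else 0) + (if m = j then if s = i then \<alpha> * F j else 0 else 0)
       + (if m = ?b i then if s = ?b j then \<beta> * F (?b i) else 0 else 0)
       + (if m = ?b i then if s = i then \<gamma> * F (?b i) else 0 else 0))"
      using s by (intro sum.cong refl) (auto simp: ent algebra_simps)
    also have "\<dots> = F s + (if s = i then \<alpha> * F j else 0) + (if s = ?b j then \<beta> * F (?b i) else 0)
       + (if s = i then \<gamma> * F (?b i) else 0)"
      using s j iN by (simp add: sum.distrib)
    finally have lhs: "ent (x * form_mat ty n * transpose_mat x) r s = \<dots>" .
    have Fs: "F s = ?e (?b s) * ((if s = ?b r then 1 else 0) + (if s = ?b j then if r = i then \<alpha> else 0 else 0)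
       + (if s = i then if r = ?b j then \<beta> else 0 else 0) + (if s = i then if r = i then \<gamma> else 0 else 0))"
      using r s i j iN bar_le[of s ty n] bar_ge[of s ty n] by (auto simp: F_def ent bar_eq_iff)
    have Fj: "\<alpha> * F j = \<alpha> * (?e (?b j) * ((if r = ?b j then 1 else 0) + (if j = ?b j then if r = i then \<alpha> else 0 else 0)))"
      using r s i j iN by (auto simp: F_def ent bar_eq_iff)
    have Fi: "F (?b i) = (if r = i then 1 else 0) + (if i = j then if r = i then \<alpha> else 0 else 0)"
      using r s i j iN by (auto simp: F_def ent bar_eq_iff ei)
    have Fs': "F s = ?e (?b s) * ((if r = ?b s then 1 else 0) + (if s = ?b j then if r = i then \<alpha> else 0 else 0)
       + (if s = i then if r = ?b j then \<beta> else 0 else 0) + (if s = i then if r = i then \<gamma> else 0 else 0))"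
      unfolding Fs using r s by auto
    have rhs: "ent (form_mat ty n :: 'a mat) r s = (if r = ?b s then ?e (?b s) else 0)"
      using r s by (auto simp: form_mat_def)
    show ?thesis
    proof (cases "\<alpha> = 0 \<and> \<beta> = 0")
      case True
      then show ?thesis unfolding lhs rhs Fs' Fi using iN c by (auto simp: algebra_simps split: if_splits)
    next
      case False
      then have ij: "i < j" "j < ?b i" "i \<noteq> ?b j" using j i by (auto simp: bar_def)
      have e_bj: "?e (?b j) = ?e (?b i) * ?e j" using eb j by blast
      have self: "?e (?b j) = 1" if "j = ?b j" using odd_C[OF that] by (simp add: form_sign_def)
      consider "s = i" | "s \<noteq> i" "s = ?b j" | "s \<noteq> i" "s \<noteq> ?b j" by blast
      then show ?thesis
      proof cases
        case 1
        consider "r = ?b i" | "r = ?b j" | "r = i" | "r \<noteq> ?b i" "r \<noteq> ?b j" "r \<noteq> i" by blast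
        then show ?thesis
        proof cases
          case 1
          then show ?thesis unfolding lhs rhs Fs' Fi Fj using \<open>s = i\<close> iN ij j by (auto simp: bar_eq_iff)
        next
          case 2
          then show ?thesis unfolding lhs rhs Fs' Fi Fj
            using \<open>s = i\<close> iN ij j by (auto simp: bar_eq_iff ab e_bj)
        next
          case 3
          then show ?thesis unfolding lhs rhs Fs' Fi Fj
            using \<open>s = i\<close> iN ij j c self by (auto simp: power2_eq_square algebra_simps split: if_splits)
        next
          case 4
          then show ?thesis unfolding lhs rhs Fs' Fi Fj
            using \<open>s = i\<close> iN ij j by auto
        qed
      next
        case 2
        then show ?thesis unfolding lhs rhs Fs' Fi
          using iN ij j by (auto simp: ab)
      next
        case 3
        then show ?thesis unfolding lhs rhs Fs' by auto
      qed
    qed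
  qed
  then show ?thesis
    using x by (auto simp: isometry_def intro!: mat_eqI_ent[of _ ?N])
qed

lemma not_self_bar: "j \<noteq> bar ty n j" if "ty \<noteq> Type_B" "j \<le> Ndim ty n"
proof
  assume "j = bar ty n j"
  then have "2 * j = 2 * n + 1" using that by (auto simp: bar_def Ndim_def)
  then show False by presburger
qed

lemma self_bar_B: "j = bar Type_B n j \<longleftrightarrow> j = n + 1" if "j \<le> Ndim Type_B n"
  using that by (auto simp: bar_def Ndim_def)

lemma isometry_xroot:
  fixes \<alpha> :: "'a::field"
  assumes two: "(2::'a) \<noteq> 0" and P: "(i, j) \<in> Ppos ty n"
  shows "isometry ty n (xroot ty n i j \<alpha>)"
proof -
  let ?N = "Ndim ty n" and ?b = "bar ty n"
  note b = Ppos_bounds[OF P]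
  have i: "1 \<le> i" "i < ?b i" using b by auto
  have C: "ty = Type_C \<Longrightarrow> j \<noteq> ?b j" "ty = Type_D \<Longrightarrow> j \<noteq> ?b j"
    "ty = Type_B \<Longrightarrow> j = ?b j \<longleftrightarrow> j = n + 1"
    using not_self_bar[of ty j n] self_bar_B[of j n] b(5) by auto
  have carr: "xroot ty n i j \<alpha> \<in> carrier_mat ?N ?N"
    by (rule carrier_matI; cases ty) (simp_all add: xroot_def Let_def)
  show ?thesis
  proof (cases "j = ?b i")
    case True
    then have "ty = Type_C" using P by (auto simp: Ppos_def Pcirc_def split: if_splits)
    moreover from this have "\<not> ?b i \<le> n" using i by (auto simp: bar_def Ndim_def)
    ultimately have x: "xroot ty n i j \<alpha> = 1\<^sub>m ?N + \<alpha> \<cdot>\<^sub>m mat_unit ?N i (?b i)"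
      using True by (simp add: xroot_def Let_def)
    show ?thesis
    proof (rule isometry_root_shape[OF carr _ i(1,2), where j = j and \<alpha> = 0 and \<beta> = 0 and \<gamma> = \<alpha>])
      fix r c assume rc: "1 \<le> r" "r \<le> ?N" "1 \<le> c" "c \<le> ?N"
      then have "ent (xroot ty n i j \<alpha>) r c = ent (1\<^sub>m ?N) r c + \<alpha> * ent (mat_unit ?N i (?b i)) r c"
        by (simp add: x ent_def mat_unit_def)
      then show "ent (xroot ty n i j \<alpha>) r c = (if c = r then 1 else 0) + (if c = j then if r = i then 0 else 0 else 0)
        + (if c = ?b i then if r = ?b j then 0 else 0 else 0) + (if c = ?b i then if r = i then \<alpha> else 0 else 0)"
        using True rc by (auto simp: ent_mat_unit ent_one)
    next
      show "\<alpha> + form_sign ty n (?b i) * \<alpha> + (if j = ?b j then (0::'a)\<^sup>2 else 0) = 0"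
        using True \<open>ty = Type_C\<close> i by (auto simp: form_sign_def bar_def Ndim_def)
    qed (use b C in auto)
  next
    case False
    then have ji: "j < ?b i" using b by simp
    define \<gamma> where "\<gamma> = (if ty = Type_B \<and> j = n + 1 then - (\<alpha>\<^sup>2 / 2) else 0)"
    have \<gamma>: "\<gamma> + form_sign ty n (?b i) * \<gamma> + (if j = ?b j then \<alpha>\<^sup>2 else 0) = 0"
      using C two by (cases ty) (auto simp: \<gamma>_def form_sign_def)
    have x: "xroot ty n i j \<alpha> = 1\<^sub>m ?N + \<alpha> \<cdot>\<^sub>m mat_unit ?N i j + (- form_sign ty n j * \<alpha>) \<cdot>\<^sub>m mat_unit ?N (?b j) (?b i)
        + \<gamma> \<cdot>\<^sub>m mat_unit ?N i (?b i)"
      using ji C by (cases ty) (auto simp: xroot_def \<gamma>_def form_sign_def mat_unit_def Let_def intro!: eq_matI)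
    show ?thesis
    proof (rule isometry_root_shape[OF carr _ i(1,2), where j = j and \<alpha> = \<alpha> and \<gamma> = \<gamma>
          and \<beta> = "- form_sign ty n j * \<alpha>"])
      fix r c assume rc: "1 \<le> r" "r \<le> ?N" "1 \<le> c" "c \<le> ?N"
      then have "ent (xroot ty n i j \<alpha>) r c = ent (1\<^sub>m ?N) r c + \<alpha> * ent (mat_unit ?N i j) r c
          + (- form_sign ty n j * \<alpha>) * ent (mat_unit ?N (?b j) (?b i)) r c + \<gamma> * ent (mat_unit ?N i (?b i)) r c"
        by (simp add: x ent_def mat_unit_def)
      then show "ent (xroot ty n i j \<alpha>) r c = (if c = r then 1 else 0) + (if c = j then if r = i then \<alpha> else 0 else 0)
        + (if c = ?b i then if r = ?b j then - form_sign ty n j * \<alpha> else 0 else 0)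
        + (if c = ?b i then if r = i then \<gamma> else 0 else 0)"
        using rc by (simp add: ent_mat_unit ent_one)
    qed (use b C ji \<gamma> in auto)
  qed
qed

lemma Ugrp_isometry:
  fixes g :: "'a::{field,finite} mat"
  assumes two: "(2::'a) \<noteq> 0" and g: "g \<in> carrier (Ugrp ty n)"
  shows "g \<in> carrier (Utilde ty n)" "isometry ty n g"
proof -
  interpret Ut: group "Utilde ty n :: 'a mat monoid" by (rule group_Utilde)
  let ?S = "carrier (Utilde ty n) \<inter> (\<Union>(i, j)\<in>Ppos ty n. Xroot ty n i j) :: 'a mat set"
  have S: "h \<in> carrier (Utilde ty n) \<and> isometry ty n h" if "h \<in> ?S" for h
    using that isometry_xroot[OF two] by (auto simp: Xroot_def)
  have "g \<in> generate (Utilde ty n) ?S"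
    using g by (simp add: Ugrp_def carrier_subgroup_generated)
  then have "g \<in> carrier (Utilde ty n) \<and> isometry ty n g"
  proof induction
    case one show ?case using Ut.one_closed isometry_one[of ty n] by simp
  next
    case (incl h) then show ?case using S by blast
  next
    case (inv h)
    then have h: "h \<in> carrier (Utilde ty n)" "isometry ty n h" using S by blast+
    show ?case
      using isometry_left_inverse[OF h(2) Utilde_carrier_mat[OF Ut.inv_closed[OF h(1)]]]
        Ut.l_inv[OF h(1)] h(1) by simp
  next
    case (eng h1 h2) then show ?case using isometry_mult Utilde_mult_closed by auto
  qed
  then show "g \<in> carrier (Utilde ty n)" "isometry ty n g" by auto
qed

text \<open>Isometries are determined by their entries in \<open>P\<close>; here this is proved for the square block
  strictly between \<open>k\<close> and \<open>bar k\<close> and for entries zero.  An entry to the right of \<open>P\<close>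
  is found by pairing its row with the row \<open>bar l\<close>, where all other terms vanish by
  triangularity or by hypothesis.  On the antidiagonal, in types B and D, the row is paired with
  itself, which gives twice the entry; this is where odd characteristic matters.  For \<open>k = 0\<close> the
  block is the whole matrix.\<close>
lemma isometry_block_trivial:
  fixes g :: "'a::field mat"
  assumes two: "(2::'a) \<noteq> 0" and g: "g \<in> carrier (Utilde ty n)" and iso: "isometry ty n g"
    and zero: "\<And>r l. (r, l) \<in> Ppos ty n \<Longrightarrow> k < r \<Longrightarrow> ent g r l = 0"
    and rl: "k < r" "r < l" "l < bar ty n k"
  shows "ent g r l = 0"
proof -
  let ?N = "Ndim ty n" and ?b = "bar ty n" and ?e = "form_sign ty n :: nat \<Rightarrow> 'a"
  have rN: "1 \<le> r" "r \<le> ?N" "1 \<le> l" "l \<le> ?N" using rl by (auto simp: bar_def)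
  have low: "ent g a c = 0" if "1 \<le> c" "c < a" "a \<le> ?N" for a c
    using Utilde_lower[OF g] that by blast
  have diag: "ent g a a = 1" if "1 \<le> a" "a \<le> ?N" for a using Utilde_diag[OF g] that .
  have inP: "ent g a c = 0" if "k < a" "a < c" "c < ?b a" for a c
  proof -
    have "(a, c) \<in> Ppos ty n" using that by (auto simp: Ppos_def Pcirc_def)
    then show ?thesis using zero that by blast
  qed
  consider "l < ?b r" | "l = ?b r" "ty = Type_C" | "l = ?b r" "ty \<noteq> Type_C" | "?b r < l" by linarith
  then show ?thesis
  proof cases
    case 1 then show ?thesis using inP rl by blast
  next
    case 2 then show ?thesis using zero[of r l] rl rN by (auto simp: Ppos_def Gam_def)
  next
    case 3
    have "(\<Sum>m=1..?N. ?e (?b m) * ent g r (?b m) * ent g r m) =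
       (\<Sum>m=1..?N. (if m = r then ent g r l else 0) + (if m = l then ent g r l else 0))"
    proof (intro sum.cong refl)
      fix m assume m: "m \<in> {1..?N}"
      consider "m < r" | "m = r" | "r < m" "m < l" | "m = l" | "m > l" by linarith
      then show "?e (?b m) * ent g r (?b m) * ent g r m =
         (if m = r then ent g r l else 0) + (if m = l then ent g r l else 0)"
      proof cases
        case 5
        then have "ent g r (?b m) = 0" using 3 m rN by (intro low) (auto simp: bar_def)
        then show ?thesis using 5 rl by simp
      qed (use m 3 rl rN low[of m r] inP[of r m] diag[of r] in \<open>auto simp: form_sign_def\<close>)
    qed
    also have "\<dots> = 2 * ent g r l" using rN by (simp add: sum.distrib)
    finally show ?thesis using isometry_rows[OF iso, of r r] rN rl 3 two by auto
  next
    case 4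
    let ?s = "?b l"
    have s: "k < ?s" "?s < r" "?s \<noteq> ?b r" "1 \<le> ?s" "?s \<le> ?N" "?b ?s = l" "?s < l"
      using 4 rl rN by (auto simp: bar_def)
    have "(\<Sum>m=1..?N. ?e (?b m) * ent g r (?b m) * ent g ?s m) =
       (\<Sum>m=1..?N. if m = ?s then ?e l * ent g r l else 0)"
    proof (intro sum.cong refl)
      fix m assume m: "m \<in> {1..?N}"
      consider "m < ?s" | "m = ?s" | "?s < m" "m < l" | "m \<ge> l" by linarith
      then show "?e (?b m) * ent g r (?b m) * ent g ?s m = (if m = ?s then ?e l * ent g r l else 0)"
      proof cases
        case 4
        then have "ent g r (?b m) = 0" using s m rN by (intro low) (auto simp: bar_def)
        then show ?thesis using 4 s by simp
      qed (use m s low[of m ?s] inP[of ?s m] diag[of ?s] in auto)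
    qed
    also have "\<dots> = ?e l * ent g r l" using s by simp
    finally have "?e l * ent g r l = 0"
      using isometry_rows[OF iso, of r ?s] s rN by simp
    then show ?thesis by (auto simp: form_sign_def split: if_splits)
  qed
qed

text \<open>Pairing row \<open>bar j\<close> with row \<open>bar l\<close> isolates the entry \<open>(bar j, l)\<close>, because row \<open>bar l\<close>
  is zero from its diagonal entry up to column \<open>j\<close>.\<close>
lemma isometry_row_trivial:
  fixes h :: "'a::field mat"
  assumes h: "h \<in> carrier (Utilde ty n)" and iso: "isometry ty n h"
    and j: "1 \<le> j" "j \<le> Ndim ty n" and l: "bar ty n j < l" "l < j"
    and zero: "\<And>r m. bar ty n j < r \<Longrightarrow> r < m \<Longrightarrow> m \<le> j \<Longrightarrow> ent h r m = 0"
  shows "ent h (bar ty n j) l = 0"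
proof -
  let ?N = "Ndim ty n" and ?b = "bar ty n" and ?e = "form_sign ty n :: nat \<Rightarrow> 'a"
  let ?k = "?b j" and ?r = "?b l"
  have b: "?k < ?r" "?r < j" "1 \<le> ?k" "?k \<le> ?N" "1 \<le> ?r" "?r \<le> ?N" "?b ?r = l" "1 \<le> l" "l \<le> ?N"
    using j l by (auto simp: bar_def)
  have "(\<Sum>m=1..?N. ?e (?b m) * ent h ?r (?b m) * ent h ?k m) =
       (\<Sum>m=1..?N. if m = l then ?e ?r * ent h ?k l else 0)"
  proof (intro sum.cong refl)
    fix m assume m: "m \<in> {1..?N}"
    have bm: "1 \<le> ?b m" "?b m \<le> ?N" "?b m = ?r \<longleftrightarrow> m = l"
      using m b by (auto simp: bar_def)
    consider "?b m < ?r" | "m = l" | "?r < ?b m" "?b m \<le> j" | "?b m > j"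
      using bm by linarith
    then show "?e (?b m) * ent h ?r (?b m) * ent h ?k m = (if m = l then ?e ?r * ent h ?k l else 0)"
    proof cases
      case 1 then show ?thesis using Utilde_lower[OF h] b bm by auto
    next
      case 2 then show ?thesis using Utilde_diag[OF h] b by auto
    next
      case 3 then show ?thesis using zero b bm by auto
    next
      case 4
      then have "m < ?k" "m \<noteq> l" using m j l by (auto simp: bar_def)
      then show ?thesis using Utilde_lower[OF h] b m by auto
    qed
  qed
  also have "\<dots> = ?e ?r * ent h ?k l" using b by simp
  finally have "?e ?r * ent h ?k l = 0"
    using isometry_rows[OF iso, of ?r ?k] b l by simp
  then show ?thesis by (auto simp: form_sign_def split: if_splits)
qed

text \<open>The stabiliser of \<open>A\<close> is cut out by equations each of which involves a single row of \<open>A\<close>.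
  Hence rows of \<open>A\<close> may be discussed one at a time.\<close>
lemma tdot_eq_iff:
  assumes A: "A \<in> Vspace ty n" and g: "g \<in> carrier (Utilde ty n)"
  shows "tdot ty n A g = A \<longleftrightarrow>
    (\<forall>(r, k)\<in>Ppos ty n. (\<Sum>l\<in>{k<..Ndim ty n}. ent A r l * ent g k l) = 0)"
proof -
  let ?N = "Ndim ty n"
  have e: "ent (tdot ty n A g) r k = ent A r k + (\<Sum>l\<in>{k<..?N}. ent A r l * ent g k l)"
    if P: "(r, k) \<in> Ppos ty n" for r k
  proof -
    note b = Ppos_bounds[OF P]
    have *: "{1..?N} = {1..<k} \<union> insert k {k<..?N}" "{1..<k} \<inter> insert k {k<..?N} = {}"
      using b by auto
    have "(\<Sum>l=1..?N. ent A r l * ent g k l) =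
        (\<Sum>l\<in>{1..<k}. ent A r l * ent g k l) + (\<Sum>l\<in>insert k {k<..?N}. ent A r l * ent g k l)"
      unfolding *(1) by (rule sum.union_disjoint) (use *(2) in auto)
    moreover have "(\<Sum>l\<in>{1..<k}. ent A r l * ent g k l) = 0"
      using b Utilde_lower[OF g] by (intro sum.neutral) auto
    ultimately show ?thesis
      unfolding ent_tdot[OF A g P] using b Utilde_diag[OF g]
      by simp
  qed
  have "tdot ty n A g = A \<longleftrightarrow> (\<forall>(r, k)\<in>Ppos ty n. ent (tdot ty n A g) r k = ent A r k)"
  proof
    assume *: "\<forall>(r, k)\<in>Ppos ty n. ent (tdot ty n A g) r k = ent A r k"
    show "tdot ty n A g = A"
    proof (rule mat_eqI_ent)
      fix i j assume ij: "i \<in> {1..?N}" "j \<in> {1..?N}"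
      show "ent (tdot ty n A g) i j = ent A i j"
        using * Vspace_ent_0[OF A _ ij] Vspace_ent_0[OF tdot_in_Vspace[of ty n A g] _ ij]
        by (cases "(i, j) \<in> Ppos ty n") auto
    qed (auto simp: Vspace_carrier A tdot_in_Vspace)
  qed auto
  then show ?thesis using e by auto
qed

section \<open>The group U acting on characters\<close>

lemma Ugrp_mult_closed:
  fixes g :: "'a::{field,finite} mat"
  assumes "g \<in> carrier (Ugrp ty n)" "h \<in> carrier (Ugrp ty n)"
  shows "g * h \<in> carrier (Ugrp ty n)"
  using group.group_subgroup_generated[OF group_Utilde]
    group.is_monoid monoid.m_closed assms unfolding Ugrp_def
  by (metis mult_Utilde mult_subgroup_generated)

lemma Ugrp_Utilde: "g \<in> carrier (Ugrp ty n) \<Longrightarrow> g \<in> carrier (Utilde ty n)" for g :: "'a::{field,finite} mat"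
  using group.carrier_subgroup_generated_subset[OF group_Utilde] unfolding Ugrp_def by blast

lemma Ugrp_inv_closed:
  fixes g :: "'a::{field,finite} mat"
  assumes "g \<in> carrier (Ugrp ty n)"
  shows "inv\<^bsub>Utilde ty n\<^esub> g \<in> carrier (Ugrp ty n)"
  using group.inv_closed[OF group.group_subgroup_generated[OF group_Utilde]]
    group.inv_subgroup_generated[OF group_Utilde] assms unfolding Ugrp_def by metis

lemma one_Ugrp [simp]: "\<one>\<^bsub>Ugrp ty n\<^esub> = 1\<^sub>m (Ndim ty n)"
  and mult_Ugrp [simp]: "mult (Ugrp ty n) = (*)"
  by (simp_all add: Ugrp_def)

lemma Ugrp_one_closed: "1\<^sub>m (Ndim ty n) \<in> carrier (Ugrp ty n :: 'a::{field,finite} mat monoid)"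
  using generate.one[of "Utilde ty n"] by (simp add: Ugrp_def carrier_subgroup_generated)

lemma finite_Ugrp: "finite (carrier (Ugrp ty n :: 'a::{field,finite} mat monoid))"
  by (rule finite_subset[OF _ finite_carrier_mat]) (auto dest: Ugrp_Utilde Utilde_carrier_mat)

lemma Utilde_inv_cancel:
  fixes g :: "'a::{field,finite} mat"
  assumes "g \<in> carrier (Utilde ty n)"
  shows "inv\<^bsub>Utilde ty n\<^esub> g * g = 1\<^sub>m (Ndim ty n)" "g * inv\<^bsub>Utilde ty n\<^esub> g = 1\<^sub>m (Ndim ty n)"
  using group.l_inv[OF group_Utilde assms] group.r_inv[OF group_Utilde assms] by auto

lemma Utilde_inv_closed: "g \<in> carrier (Utilde ty n) \<Longrightarrow> inv\<^bsub>Utilde ty n\<^esub> g \<in> carrier (Utilde ty n)"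
  for g :: "'a::{field,finite} mat"
  using group.inv_closed[OF group_Utilde] .

lemma Utilde_inv_mult:
  fixes g h :: "'a::{field,finite} mat"
  assumes "g \<in> carrier (Utilde ty n)" "h \<in> carrier (Utilde ty n)"
  shows "inv\<^bsub>Utilde ty n\<^esub> (g * h) = inv\<^bsub>Utilde ty n\<^esub> h * inv\<^bsub>Utilde ty n\<^esub> g"
  using group.inv_mult_group[OF group_Utilde assms] by simp

lemma Utilde_right_cancel:
  fixes g h k :: "'a::{field,finite} mat"
  assumes "g \<in> carrier (Utilde ty n)" "h \<in> carrier (Utilde ty n)" "k \<in> carrier (Utilde ty n)" "g * k = h * k"
  shows "g = h"
  using group.right_cancel[OF group_Utilde assms(3,1,2)] assms(4) by simp

lemma bij_betw_right_mult:
  fixes T :: "'a::{field,finite} mat set"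
  assumes "finite T" "T \<subseteq> carrier (Utilde ty n)" "s \<in> carrier (Utilde ty n)" "\<And>u. u \<in> T \<Longrightarrow> u * s \<in> T"
  shows "bij_betw (\<lambda>u. u * s) T T"
proof -
  have "inj_on (\<lambda>u. u * s) T"
    using assms(2,3) Utilde_right_cancel by (blast intro: inj_onI)
  then show ?thesis
    using endo_inj_surj[OF assms(1), of "\<lambda>u. u * s"] assms(4) by (auto simp: bij_betw_def)
qed

lemma dot_mat_tdot: "dot_mat ty n A g = tdot ty n A (inv\<^bsub>Utilde ty n\<^esub> g)"
  by (simp add: dot_mat_def tdot_def)

lemma dot_mat_in_Vspace: "dot_mat ty n A g \<in> Vspace ty n"
  by (simp add: dot_mat_tdot tdot_in_Vspace)

lemma dot_mat_mult:
  fixes A :: "'a::{field,finite} mat"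
  assumes "A \<in> Vspace ty n" "g \<in> carrier (Utilde ty n)" "h \<in> carrier (Utilde ty n)"
  shows "dot_mat ty n A (g * h) = dot_mat ty n (dot_mat ty n A g) h"
  using assms by (simp add: dot_mat_tdot Utilde_inv_mult tdot_mult Utilde_inv_closed)

lemma tdot_inverse:
  fixes A :: "'a::{field,finite} mat"
  assumes A: "A \<in> Vspace ty n" and g: "g \<in> carrier (Utilde ty n)"
  shows "tdot ty n (dot_mat ty n A g) g = A" "dot_mat ty n (tdot ty n A g) g = A"
  using assms tdot_mult[OF A g Utilde_inv_closed[OF g]] tdot_mult[OF A Utilde_inv_closed[OF g] g]
  by (simp_all add: dot_mat_tdot Utilde_inv_cancel tdot_one)

text \<open>Nontriviality of \<open>\<theta>\<close> gives the orthogonality relations that separate the characters \<open>[A]\<close>.\<close>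
locale additive_character =
  fixes \<theta> :: "'a::{field,finite} \<Rightarrow> complex"
  assumes character: "add_character \<theta>" and nontrivial: "\<exists>x. \<theta> x \<noteq> 1"
begin

lemma theta_nonzero [simp]: "\<theta> x \<noteq> 0" and theta_add: "\<theta> (x + y) = \<theta> x * \<theta> y"
  using character by (auto simp: add_character_def)

lemma theta_0 [simp]: "\<theta> 0 = 1"
  using theta_add[of 0 0] by simp

lemma theta_minus: "\<theta> (- x) = 1 / \<theta> x"
  using theta_add[of x "- x"] by (simp add: field_simps)

lemma theta_diff: "\<theta> (x - y) = \<theta> x / \<theta> y"
  using theta_add[of x "- y"] by (simp add: theta_minus)

lemma theta_mult_nontrivial: "c \<noteq> 0 \<Longrightarrow> \<exists>x. \<theta> (c * x) \<noteq> 1"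
  using nontrivial by (metis nonzero_mult_div_cancel_left times_divide_eq_right)

lemma kap_mat_of_single:
  fixes A :: "'a mat"
  assumes "A \<in> carrier_mat N N" "i \<in> {1..N}" "j \<in> {1..N}"
  shows "kap A (mat_of N (\<lambda>r c. if r = i \<and> c = j then x else 0)) = ent A i j * x"
proof -
  have "kap A (mat_of N (\<lambda>r c. if r = i \<and> c = j then x else 0)) =
      (\<Sum>r=1..N. \<Sum>c=1..N. if c = j then (if r = i then ent A i j * x else 0) else 0)"
    unfolding kap_ent[OF assms(1) mat_of_carrier] by (intro sum.cong refl) auto
  also have "\<dots> = ent A i j * x" using assms by simp
  finally show ?thesis .
qed

lemma single_in_Vspace:
  "(i, j) \<in> Ppos ty n \<Longrightarrow> mat_of (Ndim ty n) (\<lambda>r c. if r = i \<and> c = j then x else 0) \<in> Vspace ty n"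
  by (rule VspaceI) (auto split: if_splits)

lemma lchar_inj:
  assumes A: "A \<in> Vspace ty n" and B: "B \<in> Vspace ty n" and eq: "lchar ty n \<theta> A = lchar ty n \<theta> B"
  shows "A = B"
proof (rule mat_eqI_ent[OF Vspace_carrier[OF A] Vspace_carrier[OF B]])
  let ?N = "Ndim ty n"
  fix i j assume ij: "i \<in> {1..?N}" "j \<in> {1..?N}"
  show "ent A i j = ent B i j"
  proof (cases "(i, j) \<in> Ppos ty n")
    case True
    have "\<theta> ((ent B i j - ent A i j) * x) = 1" for x
    proof -
      let ?X = "mat_of ?N (\<lambda>r c. if r = i \<and> c = j then x else 0)"
      have "lchar ty n \<theta> A ?X = lchar ty n \<theta> B ?X" by (simp add: eq)
      then have "\<theta> (- (ent A i j * x)) = \<theta> (- (ent B i j * x))"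
        using single_in_Vspace[OF True, of x] ij Vspace_carrier[OF A] Vspace_carrier[OF B]
        by (simp add: lchar_def kap_uminus[of _ ?N] kap_mat_of_single)
      then show ?thesis by (simp add: theta_minus theta_diff left_diff_distrib)
    qed
    then show ?thesis using theta_mult_nontrivial[of "ent B i j - ent A i j"] by fastforce
  qed (use Vspace_ent_0 A B ij in metis)
qed

definition cocycle :: "lie_type \<Rightarrow> nat \<Rightarrow> 'a mat \<Rightarrow> 'a mat \<Rightarrow> complex" where
  "cocycle ty n A g = \<theta> (- kap A (inv\<^bsub>Utilde ty n\<^esub> g))"

lemma cocycle_nonzero [simp]: "cocycle ty n A g \<noteq> 0"
  by (simp add: cocycle_def)

lemma cocycle_mult:
  assumes A: "A \<in> Vspace ty n" and g: "g \<in> carrier (Utilde ty n)" and h: "h \<in> carrier (Utilde ty n)"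
  shows "cocycle ty n A (g * h) = cocycle ty n A g * cocycle ty n (dot_mat ty n A g) h"
  using kap_mult[OF A Utilde_inv_closed[OF h] Utilde_inv_closed[OF g]]
  by (simp add: cocycle_def Utilde_inv_mult g h dot_mat_tdot theta_diff theta_minus)

lemma hat_act_eq:
  assumes g: "g \<in> carrier (Utilde ty n)"
  shows "hat_act ty n \<theta> f g = (\<Sum>A\<in>Vspace ty n.
     hat_scale (Poly_Mapping.lookup f (lchar ty n \<theta> A) * cocycle ty n A g)
       (Poly_Mapping.single (lchar ty n \<theta> (dot_mat ty n A g)) 1))"
  unfolding hat_act_def
proof (intro sum.cong refl)
  fix A :: "'a mat" assume A: "A \<in> Vspace ty n"
  have "kap (- A) (proj ty n (inv\<^bsub>Utilde ty n\<^esub> g)) = - kap A (inv\<^bsub>Utilde ty n\<^esub> g)"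
    using kap_uminus[OF Vspace_carrier[OF A] proj_carrier, of "inv\<^bsub>Utilde ty n\<^esub> g"]
      kap_proj[OF A Utilde_carrier_mat[OF Utilde_inv_closed[OF g]]] by simp
  then show "hat_scale (Poly_Mapping.lookup f (lchar ty n \<theta> A)) (hat_scale (\<theta> (kap (- A) (proj ty n (inv\<^bsub>Utilde ty n\<^esub> g))))
        (Poly_Mapping.single (lchar ty n \<theta> (dot_mat ty n A g)) 1)) =
     hat_scale (Poly_Mapping.lookup f (lchar ty n \<theta> A) * cocycle ty n A g)
        (Poly_Mapping.single (lchar ty n \<theta> (dot_mat ty n A g)) 1)"
    by (intro poly_mapping_eqI) (simp add: lookup_hat_scale cocycle_def)
qed

lemma lookup_hat_act:
  assumes A: "A \<in> Vspace ty n" and g: "g \<in> carrier (Utilde ty n)"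
  shows "Poly_Mapping.lookup (hat_act ty n \<theta> f g) (lchar ty n \<theta> (dot_mat ty n A g)) =
     Poly_Mapping.lookup f (lchar ty n \<theta> A) * cocycle ty n A g"
proof -
  have eq: "lchar ty n \<theta> (dot_mat ty n C g) = lchar ty n \<theta> (dot_mat ty n A g) \<longleftrightarrow> C = A"
    if "C \<in> Vspace ty n" for C
    using lchar_inj[OF dot_mat_in_Vspace dot_mat_in_Vspace] tdot_inverse(1)[OF _ g] that A by metis
  have "Poly_Mapping.lookup (hat_act ty n \<theta> f g) (lchar ty n \<theta> (dot_mat ty n A g)) =
    (\<Sum>C\<in>Vspace ty n. if C = A then Poly_Mapping.lookup f (lchar ty n \<theta> A) * cocycle ty n A g else 0)"
    unfolding hat_act_eq[OF g] lookup_sum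
    by (intro sum.cong refl) (auto simp: lookup_hat_scale lookup_single when_def eq)
  also have "\<dots> = Poly_Mapping.lookup f (lchar ty n \<theta> A) * cocycle ty n A g"
    using A by (simp add: finite_Vspace)
  finally show ?thesis .
qed

lemma lookup_hat_act_outside:
  assumes g: "g \<in> carrier (Utilde ty n)" and k: "k \<notin> lchar ty n \<theta> ` Vspace ty n"
  shows "Poly_Mapping.lookup (hat_act ty n \<theta> f g) k = 0"
  unfolding hat_act_eq[OF g] lookup_sum
  using k by (intro sum.neutral) (auto simp: lookup_hat_scale lookup_single when_def dot_mat_in_Vspace)

text \<open>Since \<open>[C] \<mapsto> [C].g\<close> permutes the characters, it suffices to compare coefficients at the
  characters \<open>[A].g\<close>.\<close>
lemma hat_act_eqI:
  assumes g: "g \<in> carrier (Utilde ty n)"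
    and "\<And>A. A \<in> Vspace ty n \<Longrightarrow> Poly_Mapping.lookup (hat_act ty n \<theta> f g) (lchar ty n \<theta> (dot_mat ty n A g)) =
       Poly_Mapping.lookup h (lchar ty n \<theta> (dot_mat ty n A g))"
    and "\<And>k. k \<notin> lchar ty n \<theta> ` Vspace ty n \<Longrightarrow> Poly_Mapping.lookup h k = 0"
  shows "hat_act ty n \<theta> f g = h"
proof (rule poly_mapping_eqI)
  fix k
  show "Poly_Mapping.lookup (hat_act ty n \<theta> f g) k = Poly_Mapping.lookup h k"
  proof (cases "k \<in> lchar ty n \<theta> ` Vspace ty n")
    case True
    then obtain C where C: "C \<in> Vspace ty n" "k = lchar ty n \<theta> C" by blast
    then have "k = lchar ty n \<theta> (dot_mat ty n (tdot ty n C g) g)"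
      by (simp add: tdot_inverse(2)[OF C(1) g])
    then show ?thesis using assms(2)[OF tdot_in_Vspace] by simp
  qed (simp add: assms(3) lookup_hat_act_outside[OF g])
qed

lemma hat_act_add:
  assumes g: "g \<in> carrier (Utilde ty n)"
  shows "hat_act ty n \<theta> (f + h) g = hat_act ty n \<theta> f g + hat_act ty n \<theta> h g"
  by (rule hat_act_eqI[OF g])
     (simp_all add: lookup_hat_act g lookup_add lookup_hat_act_outside algebra_simps)

lemma hat_act_scale:
  assumes g: "g \<in> carrier (Utilde ty n)"
  shows "hat_act ty n \<theta> (hat_scale c f) g = hat_scale c (hat_act ty n \<theta> f g)"
  by (rule hat_act_eqI[OF g])
     (simp_all add: lookup_hat_act g lookup_hat_scale lookup_hat_act_outside algebra_simps)

lemma hat_act_mult: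
  assumes g: "g \<in> carrier (Utilde ty n)" and h: "h \<in> carrier (Utilde ty n)"
  shows "hat_act ty n \<theta> f (g * h) = hat_act ty n \<theta> (hat_act ty n \<theta> f g) h"
proof (rule hat_act_eqI[OF Utilde_mult_closed[OF g h]])
  fix A :: "'a mat" assume A: "A \<in> Vspace ty n"
  have "Poly_Mapping.lookup (hat_act ty n \<theta> (hat_act ty n \<theta> f g) h) (lchar ty n \<theta> (dot_mat ty n A (g * h))) =
      Poly_Mapping.lookup f (lchar ty n \<theta> A) * cocycle ty n A g * cocycle ty n (dot_mat ty n A g) h"
    by (simp add: dot_mat_mult[OF A g h] lookup_hat_act[OF dot_mat_in_Vspace h] lookup_hat_act[OF A g])
  then show "Poly_Mapping.lookup (hat_act ty n \<theta> f (g * h)) (lchar ty n \<theta> (dot_mat ty n A (g * h))) =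
      Poly_Mapping.lookup (hat_act ty n \<theta> (hat_act ty n \<theta> f g) h) (lchar ty n \<theta> (dot_mat ty n A (g * h)))"
    by (simp add: lookup_hat_act[OF A Utilde_mult_closed[OF g h]] cocycle_mult[OF A g h])
qed (simp add: lookup_hat_act_outside[OF h])

lemma hat_act_0 [simp]: "hat_act ty n \<theta> 0 g = 0"
  unfolding hat_act_def by (intro sum.neutral ballI poly_mapping_eqI) (simp add: lookup_hat_scale)

lemma hat_act_sum:
  assumes g: "g \<in> carrier (Utilde ty n)"
  shows "hat_act ty n \<theta> (\<Sum>i\<in>I. f i) g = (\<Sum>i\<in>I. hat_act ty n \<theta> (f i) g)"
  by (induction I rule: infinite_finite_induct) (simp_all add: hat_act_add[OF g])

sublocale hat: vector_space hat_scale by (rule vector_space_hat_scale)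

lemma mem_orbit:
  "u \<in> carrier (Ugrp ty n) \<Longrightarrow> lchar ty n \<theta> (dot_mat ty n A u) \<in> orbit ty n \<theta> A"
  by (auto simp: orbit_def)

lemma hat_act_orbit_module:
  assumes A: "A \<in> Vspace ty n" and f: "f \<in> orbit_module ty n \<theta> A" and g: "g \<in> carrier (Ugrp ty n)"
  shows "hat_act ty n \<theta> f g \<in> orbit_module ty n \<theta> A"
proof -
  let ?single = "\<lambda>\<chi>. Poly_Mapping.single \<chi> 1 :: ('a mat \<Rightarrow> complex) \<Rightarrow>\<^sub>0 complex"
  note gU = Ugrp_Utilde[OF g]
  have sub: "hat.subspace {f. hat_act ty n \<theta> f g \<in> orbit_module ty n \<theta> A}"
    by (rule hat.subspaceI)
       (auto simp: orbit_module_def hat_act_add[OF gU] hat_act_scale[OF gU] hat.span_zero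
          hat.span_add hat.span_scale)
  have "?single ` orbit ty n \<theta> A \<subseteq> {f. hat_act ty n \<theta> f g \<in> orbit_module ty n \<theta> A}"
  proof safe
    fix \<chi> assume "\<chi> \<in> orbit ty n \<theta> A"
    then obtain u where u: "u \<in> carrier (Ugrp ty n)" "\<chi> = lchar ty n \<theta> (dot_mat ty n A u)"
      by (auto simp: orbit_def)
    let ?\<omega> = "lchar ty n \<theta> (dot_mat ty n A (u * g))"
    have "hat_act ty n \<theta> (?single \<chi>) g = hat_scale (cocycle ty n (dot_mat ty n A u) g) (?single ?\<omega>)"
    proof (rule hat_act_eqI[OF gU])
      fix C :: "'a mat" assume C: "C \<in> Vspace ty n"
      have "lchar ty n \<theta> (dot_mat ty n A u) = lchar ty n \<theta> C \<longleftrightarrow> C = dot_mat ty n A u"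
        using lchar_inj[OF dot_mat_in_Vspace C] by blast
      moreover have "?\<omega> = lchar ty n \<theta> (dot_mat ty n C g) \<longleftrightarrow> C = dot_mat ty n A u"
        using lchar_inj[OF dot_mat_in_Vspace dot_mat_in_Vspace] tdot_inverse(1)[OF _ gU] C
          dot_mat_mult[OF A Ugrp_Utilde[OF u(1)] gU] dot_mat_in_Vspace by metis
      ultimately show "Poly_Mapping.lookup (hat_act ty n \<theta> (?single \<chi>) g) (lchar ty n \<theta> (dot_mat ty n C g)) =
          Poly_Mapping.lookup (hat_scale (cocycle ty n (dot_mat ty n A u) g) (?single ?\<omega>)) (lchar ty n \<theta> (dot_mat ty n C g))"
        by (auto simp: lookup_hat_act[OF C gU] u(2) lookup_hat_scale lookup_single when_def)
    qed (auto simp: lookup_hat_scale lookup_single when_def dot_mat_in_Vspace)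
    moreover have "?\<omega> \<in> orbit ty n \<theta> A" by (intro mem_orbit Ugrp_mult_closed u g)
    ultimately show "hat_act ty n \<theta> (?single \<chi>) g \<in> orbit_module ty n \<theta> A"
      unfolding orbit_module_def by (simp add: hat.span_scale hat.span_base)
  qed
  then show ?thesis
    using hat.span_minimal[OF _ sub] f unfolding orbit_module_def by blast
qed

end

section \<open>Eigenvectors of stabilisers and constituents\<close>

locale U_module = additive_character \<theta> + cg_module scale "Ugrp ty n" M act
  for \<theta> :: "'a::{field,finite} \<Rightarrow> complex"
    and scale :: "complex \<Rightarrow> 'v::ab_group_add \<Rightarrow> 'v" and ty :: lie_type and n :: nat
    and M :: "'v set" and act :: "'v \<Rightarrow> 'a mat \<Rightarrow> 'v"
begin

abbreviation "U \<equiv> carrier (Ugrp ty n :: 'a mat monoid)"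

text \<open>The vectors of \<open>M\<close> on which the stabiliser of \<open>[A]\<close> acts as it does on the basis vector \<open>[A]\<close>
  itself.  Indeed \<open>g\<close> multiplies \<open>[A]\<close> by \<open>\<theta> (- kap A g\<^sup>-\<^sup>1)\<close>, which equals \<open>\<theta> (kap A g)\<close> on the
  stabiliser by the cocycle identity.\<close>
definition stab_eigenvector :: "'a mat \<Rightarrow> 'v \<Rightarrow> bool" where
  "stab_eigenvector A v \<longleftrightarrow> v \<in> M \<and> v \<noteq> 0 \<and>
     (\<forall>g\<in>U. tdot ty n A g = A \<longrightarrow> act v g = scale (\<theta> (kap A g)) v)"

lemma act_mult': "v \<in> M \<Longrightarrow> g \<in> U \<Longrightarrow> h \<in> U \<Longrightarrow> act v (g * h) = act (act v g) h"
  using act_mult[of v g h] by simp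

lemma act_zero: "g \<in> U \<Longrightarrow> act 0 g = 0"
  using act_scale[of 0 g 0] W_subspace subspace_0 by force

lemma act_sum:
  assumes "\<And>i. i \<in> I \<Longrightarrow> f i \<in> M" "g \<in> U"
  shows "act (\<Sum>i\<in>I. f i) g = (\<Sum>i\<in>I. act (f i) g)"
  using assms(1)
proof (induction I rule: infinite_finite_induct)
  case (insert x I)
  then have "(\<Sum>i\<in>I. f i) \<in> M" using W_subspace by (intro subspace_sum) auto
  then show ?case using insert assms(2) by (simp add: act_add)
qed (use act_zero assms(2) in auto)

lemma sum_reindex_U: "g \<in> U \<Longrightarrow> (\<Sum>u\<in>U. F (u * g)) = (\<Sum>u\<in>U. F u)"
  by (rule sum.reindex_bij_betw[OF bij_betw_right_mult[of _ ty n]])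
     (auto simp: finite_Ugrp Ugrp_Utilde Ugrp_mult_closed)

text \<open>Up to the order of the stabiliser, this is the homomorphism that extends \<open>[B] \<mapsto> v\<close> to the
  orbit module.  Summing over all of \<open>U\<close>, rather than over the orbit, avoids choosing coset
  representatives.\<close>
definition eval_map :: "'a mat \<Rightarrow> 'v \<Rightarrow> (('a mat \<Rightarrow> complex) \<Rightarrow>\<^sub>0 complex) \<Rightarrow> 'v" where
  "eval_map B v f = (\<Sum>u\<in>U.
     scale (Poly_Mapping.lookup f (lchar ty n \<theta> (dot_mat ty n B u)) / cocycle ty n B u) (act v u))"

lemma eval_map_closed: "v \<in> M \<Longrightarrow> eval_map B v f \<in> M"
  unfolding eval_map_def using W_subspace by (intro subspace_sum subspace_scale) (auto intro: act_closed)

lemma linear_eval_map: "Vector_Spaces.linear hat_scale scale (eval_map B v)"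
proof (intro Vector_Spaces.linear_iff[THEN iffD2] conjI allI)
  show "vector_space hat_scale" by (rule vector_space_hat_scale)
  show "vector_space scale" ..
qed (simp_all add: eval_map_def lookup_add lookup_hat_scale add_divide_distrib scale_left_distrib
      sum.distrib scale_sum_right)

lemma eval_map_hat_act:
  assumes B: "B \<in> Vspace ty n" and v: "v \<in> M" and g: "g \<in> U"
  shows "eval_map B v (hat_act ty n \<theta> f g) = act (eval_map B v f) g"
proof -
  note gU = Ugrp_Utilde[OF g]
  have "eval_map B v (hat_act ty n \<theta> f g) = (\<Sum>u\<in>U. scale (Poly_Mapping.lookup (hat_act ty n \<theta> f g)
      (lchar ty n \<theta> (dot_mat ty n B (u * g))) / cocycle ty n B (u * g)) (act v (u * g)))"
    unfolding eval_map_def by (rule sum_reindex_U[OF g, symmetric])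
  also have "\<dots> = (\<Sum>u\<in>U. act (scale (Poly_Mapping.lookup f (lchar ty n \<theta> (dot_mat ty n B u)) / cocycle ty n B u) (act v u)) g)"
    by (intro sum.cong refl)
       (simp add: dot_mat_mult[OF B Ugrp_Utilde gU] lookup_hat_act[OF dot_mat_in_Vspace gU]
         cocycle_mult[OF B Ugrp_Utilde gU] act_mult'[OF v _ g] act_scale[OF act_closed[OF v] g])
  also have "\<dots> = act (eval_map B v f) g"
    unfolding eval_map_def
    using W_subspace by (intro act_sum[symmetric] g subspace_scale) (auto intro: act_closed v)
  finally show ?thesis .
qed

lemma eval_map_generator:
  assumes B: "B \<in> Vspace ty n" and v: "stab_eigenvector B v"
  shows "\<exists>c. c \<noteq> 0 \<and> eval_map B v (Poly_Mapping.single (lchar ty n \<theta> B) 1) = scale c v"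
proof -
  let ?S = "{u \<in> U. dot_mat ty n B u = B}"
  have act: "act v u = scale (cocycle ty n B u) v" if u: "u \<in> ?S" for u
  proof -
    from u have uU: "u \<in> U" "u \<in> carrier (Utilde ty n)" by (auto intro: Ugrp_Utilde)
    have st: "tdot ty n B u = B" using tdot_inverse(1)[OF B uU(2)] u by simp
    have "kap B u + kap B (inv\<^bsub>Utilde ty n\<^esub> u) = 0"
      using kap_mult[OF B uU(2) Utilde_inv_closed[OF uU(2)]] u kap_one[OF B]
      by (simp add: Utilde_inv_cancel[OF uU(2)] dot_mat_tdot)
    then have "- kap B (inv\<^bsub>Utilde ty n\<^esub> u) = kap B u" by (simp add: add_eq_0_iff)
    then show ?thesis using v uU st by (simp add: stab_eigenvector_def cocycle_def)
  qed
  have "eval_map B v (Poly_Mapping.single (lchar ty n \<theta> B) 1) = (\<Sum>u\<in>U. if dot_mat ty n B u = B then v else 0)"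
    unfolding eval_map_def
  proof (intro sum.cong refl)
    fix u assume u: "u \<in> U"
    have "lchar ty n \<theta> B = lchar ty n \<theta> (dot_mat ty n B u) \<longleftrightarrow> dot_mat ty n B u = B"
      using lchar_inj[OF B dot_mat_in_Vspace] by metis
    then show "scale (Poly_Mapping.lookup (Poly_Mapping.single (lchar ty n \<theta> B) 1)
        (lchar ty n \<theta> (dot_mat ty n B u)) / cocycle ty n B u) (act v u) =
        (if dot_mat ty n B u = B then v else 0)"
      using act u by (auto simp: lookup_single when_def)
  qed
  also have "\<dots> = (\<Sum>u\<in>?S. v)" by (rule sum.inter_filter[OF finite_Ugrp, symmetric])
  also have "\<dots> = scale (of_nat (card ?S)) v"
    by (simp add: sum_constant_scale)
  finally have "eval_map B v (Poly_Mapping.single (lchar ty n \<theta> B) 1) = scale (of_nat (card ?S)) v" .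
  moreover have "1\<^sub>m (Ndim ty n) \<in> ?S"
    using Ugrp_one_closed[of ty n] tdot_inverse(1)[OF B Ugrp_Utilde[OF Ugrp_one_closed]]
      tdot_one[OF dot_mat_in_Vspace[of ty n B "1\<^sub>m (Ndim ty n)"]] by auto
  then have "card ?S \<noteq> 0" by (auto simp: card_eq_0_iff finite_Ugrp)
  ultimately show ?thesis by (intro exI[of _ "of_nat (card ?S)"] conjI) auto
qed

lemma subspace_orbit_module: "hat.subspace (orbit_module ty n \<theta> B)"
  by (simp add: orbit_module_def)

text \<open>Frobenius reciprocity followed by Maschke: an eigenvector \<open>v\<close> gives a nonzero homomorphism from
  the orbit module onto \<open>M\<close>, and averaging a linear section of it over the group splits it.\<close>
lemma stab_eigenvector_imp_constituent:
  assumes irr: "cg_irreducible scale (Ugrp ty n) M act"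
    and B: "B \<in> Vspace ty n" and v: "stab_eigenvector B v"
  shows "cg_constituent (Ugrp ty n) scale M act hat_scale (orbit_module ty n \<theta> B) (hat_act ty n \<theta>)"
proof -
  let ?OM = "orbit_module ty n \<theta> B" and ?inv = "\<lambda>u. inv\<^bsub>Utilde ty n\<^esub> u"
  let ?\<phi> = "eval_map B v"
  interpret \<phi>: Vector_Spaces.linear hat_scale scale ?\<phi> by (rule linear_eval_map)
  interpret VP: vector_space_pair hat_scale scale ..
  have vM: "v \<in> M" and v0: "v \<noteq> 0" using v by (auto simp: stab_eigenvector_def)
  note OM = subspace_orbit_module[of B]
  note \<phi>_act = eval_map_hat_act[OF B vM]
  note [simp] = Ugrp_inv_closed
  have "cg_submodule scale (Ugrp ty n) M act (?\<phi> ` ?OM)"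
    unfolding cg_submodule_def
  proof (intro conjI ballI)
    show "?\<phi> ` ?OM \<subseteq> M" using eval_map_closed[OF vM] by blast
    show "subspace (?\<phi> ` ?OM)" by (rule \<phi>.subspace_image[OF OM])
    fix w g assume "w \<in> ?\<phi> ` ?OM" and g: "g \<in> U"
    then obtain f where "f \<in> ?OM" "w = ?\<phi> f" by blast
    then show "act w g \<in> ?\<phi> ` ?OM"
      using \<phi>_act[OF g, of f] hat_act_orbit_module[OF B _ g] by (metis imageI)
  qed
  moreover have "?\<phi> ` ?OM \<noteq> {0}"
  proof -
    have "lchar ty n \<theta> B \<in> orbit ty n \<theta> B"
      using mem_orbit[OF Ugrp_one_closed[of ty n], of B] tdot_one[OF dot_mat_in_Vspace[of ty n B "1\<^sub>m (Ndim ty n)"]]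
        tdot_inverse(1)[OF B Ugrp_Utilde[OF Ugrp_one_closed]] by simp
    then have "Poly_Mapping.single (lchar ty n \<theta> B) 1 \<in> ?OM"
      by (auto simp: orbit_module_def intro!: hat.span_base)
    moreover obtain c where "c \<noteq> 0" "?\<phi> (Poly_Mapping.single (lchar ty n \<theta> B) 1) = scale c v"
      using eval_map_generator[OF B v] by blast
    ultimately show ?thesis using v0 by (metis imageI scale_eq_0_iff singletonD)
  qed
  ultimately have surj: "?\<phi> ` ?OM = M"
    using irr unfolding cg_irreducible_def by blast
  obtain s where s: "s ` UNIV \<subseteq> ?OM" "Vector_Spaces.linear scale hat_scale s" "\<forall>m\<in>M. ?\<phi> (s m) = m"
    using VP.linear_exists_right_inverse_on[OF linear_eval_map OM, of B v] unfolding surj by auto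
  interpret s: Vector_Spaces.linear scale hat_scale s by (rule s(2))
  define \<psi> where "\<psi> m = hat_scale (1 / of_nat (card U)) (\<Sum>u\<in>U. hat_act ty n \<theta> (s (act m (?inv u))) u)" for m
  have \<psi>_OM: "\<psi> m \<in> ?OM" for m
    unfolding \<psi>_def using s(1)
    by (intro hat.subspace_scale[OF OM] hat.subspace_sum[OF OM] hat_act_orbit_module[OF B]) auto
  have \<phi>\<psi>: "?\<phi> (\<psi> m) = m" if m: "m \<in> M" for m
  proof -
    have "?\<phi> (\<psi> m) = scale (1 / of_nat (card U)) (\<Sum>u\<in>U. act (?\<phi> (s (act m (?inv u)))) u)"
      by (simp add: \<psi>_def \<phi>.scale \<phi>.sum \<phi>_act)
    also have "(\<Sum>u\<in>U. act (?\<phi> (s (act m (?inv u)))) u) = (\<Sum>u\<in>U. m)"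
      using m act_one[of m]
      by (intro sum.cong refl)
         (simp add: s(3) act_closed Utilde_inv_cancel Ugrp_Utilde flip: act_mult')
    also have "scale (1 / of_nat (card U)) (\<Sum>u\<in>U. m) = m"
      using finite_Ugrp[of ty n] Ugrp_one_closed[of ty n] by (auto simp: sum_constant_scale card_eq_0_iff)
    finally show ?thesis .
  qed
  have \<psi>_add: "\<psi> (x + y) = \<psi> x + \<psi> y" if "x \<in> M" "y \<in> M" for x y
    using that by (simp add: \<psi>_def act_add s.add hat_act_add Ugrp_Utilde sum.distrib hat.scale_right_distrib)
  have \<psi>_scale: "\<psi> (scale c x) = hat_scale c (\<psi> x)" if "x \<in> M" for c x
    using that by (simp add: \<psi>_def act_scale s.scale hat_act_scale Ugrp_Utilde hat.scale_sum_right mult.commute)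
  have \<psi>_act: "\<psi> (act m g) = hat_act ty n \<theta> (\<psi> m) g" if m: "m \<in> M" and g: "g \<in> U" for m g
  proof -
    note gU = Ugrp_Utilde[OF g]
    \<comment> \<open>The averaged section is equivariant because the substitution \<open>u \<mapsto> u g\<close> absorbs \<open>g\<close>.\<close>
    have inv: "g * ?inv (u * g) = ?inv u" if u: "u \<in> U" for u
    proof -
      have "g * (?inv g * ?inv u) = (g * ?inv g) * ?inv u"
        using Utilde_carrier_mat[OF gU] Utilde_carrier_mat[OF Utilde_inv_closed[OF gU]]
          Utilde_carrier_mat[OF Utilde_inv_closed[OF Ugrp_Utilde[OF u]]] by simp
      then show ?thesis
        using Utilde_carrier_mat[OF Utilde_inv_closed[OF Ugrp_Utilde[OF u]]]
        by (simp add: Utilde_inv_mult Ugrp_Utilde u gU Utilde_inv_cancel)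
    qed
    have "(\<Sum>u\<in>U. hat_act ty n \<theta> (s (act (act m g) (?inv u))) u) =
        (\<Sum>u\<in>U. hat_act ty n \<theta> (s (act (act m g) (?inv (u * g)))) (u * g))"
      by (rule sum_reindex_U[OF g, symmetric])
    also have "\<dots> = (\<Sum>u\<in>U. hat_act ty n \<theta> (hat_act ty n \<theta> (s (act m (?inv u))) u) g)"
      using m g
      by (intro sum.cong refl)
         (simp add: inv hat_act_mult Ugrp_Utilde Ugrp_mult_closed flip: act_mult')
    finally show ?thesis
      by (simp add: \<psi>_def hat_act_scale[OF gU] hat_act_sum[OF gU])
  qed
  let ?S = "\<psi> ` M" and ?T = "{f \<in> ?OM. ?\<phi> f = 0}"
  have zero_M: "0 \<in> M" using W_subspace by (rule subspace_0)
  have \<psi>_0: "\<psi> 0 = 0" using \<psi>_scale[OF zero_M, of 0] by simp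
  show ?thesis
    unfolding cg_constituent_def
  proof (rule exI[of _ ?S], rule exI[of _ ?T], intro conjI)
    show "cg_submodule hat_scale (Ugrp ty n) ?OM (hat_act ty n \<theta>) ?S"
      unfolding cg_submodule_def
    proof (intro conjI ballI)
      show "?S \<subseteq> ?OM" using \<psi>_OM by blast
      show "hat.subspace ?S"
      proof (rule hat.subspaceI)
        show "0 \<in> ?S" using zero_M \<psi>_0 by force
        show "x + y \<in> ?S" if "x \<in> ?S" "y \<in> ?S" for x y
          using that W_subspace by (auto simp: subspace_add simp flip: \<psi>_add)
        show "hat_scale c x \<in> ?S" if "x \<in> ?S" for c x
          using that W_subspace by (auto simp: subspace_scale simp flip: \<psi>_scale)
      qed
      show "hat_act ty n \<theta> x g \<in> ?S" if "x \<in> ?S" "g \<in> U" for x g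
        using that by (auto simp: act_closed simp flip: \<psi>_act)
    qed
    show "cg_submodule hat_scale (Ugrp ty n) ?OM (hat_act ty n \<theta>) ?T"
      unfolding cg_submodule_def
    proof (intro conjI ballI)
      show "hat.subspace ?T"
        using OM by (intro hat.subspaceI)
          (auto simp: \<phi>.zero \<phi>.add \<phi>.scale hat.subspace_0 hat.subspace_add hat.subspace_scale)
      show "hat_act ty n \<theta> x g \<in> ?T" if "x \<in> ?T" "g \<in> U" for x g
        using that \<phi>_act[of g x] by (auto simp: act_zero hat_act_orbit_module[OF B])
      show "?T \<subseteq> ?OM" by blast
    qed
    show "?S \<inter> ?T = {0}"
    proof (intro equalityI subsetI)
      fix x assume "x \<in> ?S \<inter> ?T"
      then obtain m where "m \<in> M" "x = \<psi> m" "?\<phi> x = 0" by blast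
      then show "x \<in> {0}" using \<phi>\<psi>[of m] \<psi>_0 by simp
    next
      fix x :: "('a mat \<Rightarrow> complex) \<Rightarrow>\<^sub>0 complex" assume "x \<in> {0}"
      then show "x \<in> ?S \<inter> ?T"
        using \<psi>_0 zero_M hat.subspace_0[OF OM] \<phi>.zero by (metis (mono_tags, lifting) IntI imageI mem_Collect_eq singletonD)
    qed
    show "?OM = {x + y | x y. x \<in> ?S \<and> y \<in> ?T}"
    proof (intro equalityI subsetI)
      fix f assume f: "f \<in> ?OM"
      then have fM: "?\<phi> f \<in> M" by (intro eval_map_closed[OF vM])
      have T: "f - \<psi> (?\<phi> f) \<in> ?T"
        using f \<psi>_OM \<phi>\<psi>[OF fM] hat.subspace_diff[OF OM] by (simp add: \<phi>.diff)
      show "f \<in> {x + y | x y. x \<in> ?S \<and> y \<in> ?T}"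
      proof (rule CollectI, intro exI conjI)
        show "f = \<psi> (?\<phi> f) + (f - \<psi> (?\<phi> f))" by simp
        show "\<psi> (?\<phi> f) \<in> ?S" using fM by (rule imageI)
        show "f - \<psi> (?\<phi> f) \<in> ?T" by (rule T)
      qed
    next
      fix f assume "f \<in> {x + y | x y. x \<in> ?S \<and> y \<in> ?T}"
      then obtain m y where "f = \<psi> m + y" "y \<in> ?OM" by blast
      then show "f \<in> ?OM" using hat.subspace_add[OF OM \<psi>_OM] by simp
    qed
    have "inj_on \<psi> M" by (rule inj_on_inverseI[of _ ?\<phi>]) (rule \<phi>\<psi>)
    then show "cg_isomorphic (Ugrp ty n) scale M act hat_scale ?S (hat_act ty n \<theta>)"
      unfolding cg_isomorphic_def
      using \<psi>_add \<psi>_scale \<psi>_act by (intro exI[of _ \<psi>] conjI ballI allI) (simp_all add: bij_betw_def)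
  qed
qed

end

section \<open>Changing the rows of a matrix\<close>

lemma kap_commute:
  fixes A B :: "'a::comm_ring mat"
  assumes "A \<in> carrier_mat N N" "B \<in> carrier_mat N N"
  shows "kap A B = kap B A"
  by (simp add: kap_ent[OF assms] kap_ent[OF assms(2,1)] mult.commute)

definition lower_rows :: "lie_type \<Rightarrow> nat \<Rightarrow> nat \<Rightarrow> 'a::zero mat set" where
  "lower_rows ty n k = {B \<in> Vspace ty n. \<forall>i\<in>{1..Ndim ty n}. \<forall>j\<in>{1..Ndim ty n}. i \<le> k \<longrightarrow> ent B i j = 0}"

lemma Vspace_add:
  fixes A B :: "'a::comm_ring mat"
  assumes "A \<in> Vspace ty n" "B \<in> Vspace ty n"
  shows "A + B \<in> Vspace ty n"
proof (rule VspaceI)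
  fix i j assume ij: "i \<in> {1..Ndim ty n}" "j \<in> {1..Ndim ty n}" and nz: "ent (A + B) i j \<noteq> 0"
  then show "(i, j) \<in> Ppos ty n"
    using ent_add[OF Vspace_carrier Vspace_carrier, OF assms ij] Vspace_ent_0[OF assms(1) _ ij]
      Vspace_ent_0[OF assms(2) _ ij] by force
qed (intro add_carrier_mat Vspace_carrier assms)

context additive_character
begin

text \<open>Orthogonality of characters: unless the functional \<open>B \<mapsto> kap B g\<close> vanishes on \<open>lower_rows\<close>, a
  translation of the summation variable multiplies the sum by a number different from \<open>1\<close>.\<close>
lemma sum_theta_lower_rows:
  fixes g :: "'a mat"
  assumes g: "g \<in> carrier_mat (Ndim ty n) (Ndim ty n)"
  shows "(\<Sum>B\<in>lower_rows ty n k. \<theta> (- kap B g)) =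
    (if \<forall>(i, j)\<in>Ppos ty n. k < i \<longrightarrow> ent g i j = 0 then of_nat (card (lower_rows ty n k :: 'a mat set)) else 0)"
proof (cases "\<forall>(i, j)\<in>Ppos ty n. k < i \<longrightarrow> ent g i j = 0")
  case True
  have "kap B g = 0" if B: "B \<in> lower_rows ty n k" for B
  proof -
    have BV: "B \<in> Vspace ty n" using B by (simp add: lower_rows_def)
    have "ent B i j * ent g i j = 0" if ij: "i \<in> {1..Ndim ty n}" "j \<in> {1..Ndim ty n}" for i j
    proof (cases "(i, j) \<in> Ppos ty n \<and> k < i")
      case False
      then have "ent B i j = 0" using B ij Vspace_ent_0[OF BV _ ij] by (auto simp: lower_rows_def)
      then show ?thesis by simp
    qed (use True in auto)
    then show ?thesis
      unfolding kap_ent[OF Vspace_carrier[OF BV] g] by (intro sum.neutral ballI) auto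
  qed
  then show ?thesis using True by simp
next
  case False
  then obtain a b where ab: "(a, b) \<in> Ppos ty n" "k < a" "ent g a b \<noteq> 0" by auto
  note bd = Ppos_bounds[OF ab(1)]
  obtain x where x: "\<theta> (ent g a b * x) \<noteq> 1" using theta_mult_nontrivial[OF ab(3)] by blast
  let ?X = "mat_of (Ndim ty n) (\<lambda>r c. if r = a \<and> c = b then x else 0)"
  let ?L = "lower_rows ty n k :: 'a mat set"
  have XV: "?X \<in> Vspace ty n" by (rule single_in_Vspace[OF ab(1)])
  have "kap ?X g = ent g a b * x"
    using kap_commute[OF mat_of_carrier g] kap_mat_of_single[OF g bd(6,7)] by simp
  then have kapX: "\<theta> (- kap (B + ?X) g) = \<theta> (- kap B g) / \<theta> (ent g a b * x)" if "B \<in> ?L" for B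
    using that kap_add_left[OF Vspace_carrier mat_of_carrier g, of B]
    by (simp add: lower_rows_def theta_minus theta_add theta_diff)
  have X0: "ent ?X i j = 0" if "i \<le> k" "i \<in> {1..Ndim ty n}" "j \<in> {1..Ndim ty n}" for i j
    using that ab(2) by simp
  have "bij_betw (\<lambda>B. B + ?X) ?L ?L"
  proof -
    have "finite ?L" by (rule finite_subset[OF _ finite_Vspace]) (auto simp: lower_rows_def)
    moreover have "(\<lambda>B. B + ?X) ` ?L \<subseteq> ?L"
      using Vspace_add[OF _ XV] X0 by (auto simp: lower_rows_def ent_add[OF Vspace_carrier mat_of_carrier])
    moreover have "inj_on (\<lambda>B. B + ?X) ?L"
    proof (rule inj_onI)
      fix B B' assume B: "B \<in> ?L" "B' \<in> ?L" and eq: "B + ?X = B' + ?X"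
      then have V: "B \<in> Vspace ty n" "B' \<in> Vspace ty n" by (auto simp: lower_rows_def)
      show "B = B'"
      proof (rule mat_eqI_ent[OF V[THEN Vspace_carrier]])
        fix i j assume ij: "i \<in> {1..Ndim ty n}" "j \<in> {1..Ndim ty n}"
        then show "ent B i j = ent B' i j"
          using arg_cong[OF eq, of "\<lambda>A. ent A i j"]
          unfolding ent_add[OF Vspace_carrier[OF V(1)] mat_of_carrier ij]
            ent_add[OF Vspace_carrier[OF V(2)] mat_of_carrier ij] by simp
      qed
    qed
    ultimately show ?thesis using endo_inj_surj[of ?L] by (auto simp: bij_betw_def)
  qed
  then have "(\<Sum>B\<in>?L. \<theta> (- kap (B + ?X) g)) = (\<Sum>B\<in>?L. \<theta> (- kap B g))"
    by (rule sum.reindex_bij_betw)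
  then have "(\<Sum>B\<in>?L. \<theta> (- kap B g)) / \<theta> (ent g a b * x) = (\<Sum>B\<in>?L. \<theta> (- kap B g))"
    by (simp add: kapX sum_divide_distrib)
  then have "(\<Sum>B\<in>?L. \<theta> (- kap B g)) = 0" using x by (simp add: field_simps)
  then show ?thesis unfolding if_not_P[OF False] .
qed

end

context U_module
begin

text \<open>Suppose that the rows \<open>1, \<dots>, k\<close> are prescribed by \<open>A\<close> and that \<open>v\<close> behaves correctly under those
  elements of the stabiliser \<open>T\<close> of \<open>A\<close> which are trivial in the remaining rows.  Fourier transform
  in the remaining rows then produces an eigenvector: each of the vectors
  \<open>w B = (\<Sum>u\<in>T. \<theta> (- kap (A + B) u) v u)\<close> is an eigenvector for \<open>A + B\<close> or zero, and they cannot all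
  be zero since their sum over \<open>B\<close> is a nonzero multiple of \<open>v\<close>.\<close>
lemma exists_stab_eigenvector:
  assumes A: "A \<in> Vspace ty n" and A_rows: "\<And>i j. (i, j) \<in> Ppos ty n \<Longrightarrow> k < i \<Longrightarrow> ent A i j = 0"
    and v: "v \<in> M" "v \<noteq> 0"
    and H: "\<And>h. h \<in> U \<Longrightarrow> tdot ty n A h = A \<Longrightarrow> (\<And>i j. (i, j) \<in> Ppos ty n \<Longrightarrow> k < i \<Longrightarrow> ent h i j = 0)
         \<Longrightarrow> act v h = scale (\<theta> (kap A h)) v"
  shows "\<exists>B w. B \<in> Vspace ty n \<and> stab_eigenvector B w \<and>
    (\<forall>i\<in>{1..Ndim ty n}. \<forall>j\<in>{1..Ndim ty n}. i \<le> k \<longrightarrow> ent B i j = ent A i j)"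
proof -
  let ?N = "Ndim ty n" and ?L = "lower_rows ty n k :: 'a mat set"
  define T where "T = {u \<in> U. tdot ty n A u = A}"
  define H' where "H' = {u \<in> T. \<forall>(i, j)\<in>Ppos ty n. k < i \<longrightarrow> ent u i j = 0}"
  define w where "w B = (\<Sum>u\<in>T. scale (\<theta> (- kap (A + B) u)) (act v u))" for B
  note Ac = Vspace_carrier[OF A]
  have finT: "finite T" "T \<subseteq> U" by (auto simp: T_def finite_Ugrp)
  then have TU: "u \<in> carrier (Utilde ty n)" "u \<in> carrier_mat ?N ?N" if "u \<in> T" for u
    using that Ugrp_Utilde Utilde_carrier_mat by blast+
  have LV: "B \<in> Vspace ty n" "B \<in> carrier_mat ?N ?N" if "B \<in> ?L" for B
    using that Vspace_carrier by (auto simp: lower_rows_def)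
  have finL: "finite ?L" by (rule finite_subset[OF _ finite_Vspace]) (auto simp: lower_rows_def)
  have "(\<Sum>B\<in>?L. w B) = (\<Sum>u\<in>T. \<Sum>B\<in>?L. scale (\<theta> (- kap A u) * \<theta> (- kap B u)) (act v u))"
    unfolding w_def
    by (subst sum.swap) (intro sum.cong refl, simp add: kap_add_left[OF Ac] LV TU theta_minus theta_diff)
  also have "\<dots> = (\<Sum>u\<in>T. scale (\<theta> (- kap A u) * (\<Sum>B\<in>?L. \<theta> (- kap B u))) (act v u))"
    by (simp add: scale_sum_left sum_distrib_left)
  also have "\<dots> = (\<Sum>u\<in>T. if u \<in> H' then scale (of_nat (card ?L)) v else 0)"
  proof (intro sum.cong refl)
    fix u assume u: "u \<in> T"
    show "scale (\<theta> (- kap A u) * (\<Sum>B\<in>?L. \<theta> (- kap B u))) (act v u) = (if u \<in> H' then scale (of_nat (card ?L)) v else 0)"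
    proof (cases "u \<in> H'")
      case True
      then have "act v u = scale (\<theta> (kap A u)) v" by (intro H) (auto simp: H'_def T_def)
      then show ?thesis
        using True unfolding sum_theta_lower_rows[OF TU(2)[OF u]] by (simp add: H'_def theta_minus)
    next
      case False
      then have "\<not> (\<forall>(i, j)\<in>Ppos ty n. k < i \<longrightarrow> ent u i j = 0)" using u by (simp add: H'_def)
      then show ?thesis
        unfolding sum_theta_lower_rows[OF TU(2)[OF u]] using False by (simp only: if_False) simp
    qed
  qed
  also have "\<dots> = (\<Sum>u\<in>H'. scale (of_nat (card ?L)) v)"
    using finT(1) by (simp add: H'_def sum.inter_filter)
  also have "\<dots> = scale (of_nat (card H') * of_nat (card ?L)) v"
    by (simp add: sum_constant_scale)
  finally have sum_w: "(\<Sum>B\<in>?L. w B) = scale (of_nat (card H') * of_nat (card ?L)) v" .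
  have "1\<^sub>m ?N \<in> H'"
    using Ppos_bounds(2,6,7) by (fastforce simp: H'_def T_def Ugrp_one_closed tdot_one[OF A] ent_one)
  moreover have "0\<^sub>m ?N ?N \<in> ?L" by (auto simp: lower_rows_def ent_def intro!: VspaceI)
  ultimately have "card H' \<noteq> 0" "card ?L \<noteq> 0"
    using finT(1) finL by (auto simp: card_eq_0_iff H'_def)
  then have "(\<Sum>B\<in>?L. w B) \<noteq> 0" using v(2) by (simp add: sum_w)
  then obtain B where B: "B \<in> ?L" "w B \<noteq> 0" by (meson sum.neutral)
  let ?C = "A + B"
  have C: "?C \<in> Vspace ty n" by (rule Vspace_add[OF A LV(1)[OF B(1)]])
  have C_rows: "ent ?C i j = ent A i j" if "i \<in> {1..?N}" "j \<in> {1..?N}" "i \<le> k" for i j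
    using that B(1) ent_add[OF Ac LV(2)[OF B(1)]] by (simp add: lower_rows_def)
  have "stab_eigenvector ?C (w B)"
    unfolding stab_eigenvector_def
  proof (intro conjI ballI impI)
    show "w B \<in> M"
      unfolding w_def using W_subspace v(1) finT(2)
      by (intro subspace_sum subspace_scale) (auto intro: act_closed)
    show "w B \<noteq> 0" by (rule B(2))
    fix s assume s: "s \<in> U" and stab: "tdot ty n ?C s = ?C"
    note sU = Ugrp_Utilde[OF s]
    have sT: "tdot ty n A s = A"
      unfolding tdot_eq_iff[OF A sU]
    proof (clarify)
      fix r c assume rc: "(r, c) \<in> Ppos ty n"
      note b = Ppos_bounds[OF rc]
      show "(\<Sum>l\<in>{c<..?N}. ent A r l * ent s c l) = 0"
      proof (cases "r \<le> k")
        case True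
        then have "(\<Sum>l\<in>{c<..?N}. ent A r l * ent s c l) = (\<Sum>l\<in>{c<..?N}. ent ?C r l * ent s c l)"
          using b by (intro sum.cong refl) (auto simp: C_rows)
        also have "\<dots> = 0" using stab rc unfolding tdot_eq_iff[OF C sU] by auto
        finally show ?thesis .
      next
        case False
        have "ent A r l = 0" if "l \<in> {c<..?N}" for l
          using A_rows[of r l] Vspace_ent_0[OF A, of r l] False b that by (cases "(r, l) \<in> Ppos ty n") auto
        then show ?thesis by simp
      qed
    qed
    have bij: "bij_betw (\<lambda>u. u * s) T T"
    proof (rule bij_betw_right_mult[OF finT(1) _ sU])
      fix u assume u: "u \<in> T"
      then show "u * s \<in> T"
        using tdot_mult[OF A TU(1)[OF u] sU] sT Ugrp_mult_closed[OF _ s] by (auto simp: T_def)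
    qed (use TU in blast)
    have "scale (\<theta> (kap ?C s)) (w B) =
        (\<Sum>u\<in>T. scale (\<theta> (kap ?C s)) (scale (\<theta> (- kap ?C (u * s))) (act v (u * s))))"
      unfolding w_def scale_sum_right
      by (rule sum.reindex_bij_betw[OF bij, symmetric])
    also have "\<dots> = (\<Sum>u\<in>T. act (scale (\<theta> (- kap ?C u)) (act v u)) s)"
    proof (intro sum.cong refl)
      fix u assume u: "u \<in> T"
      have "kap ?C (u * s) = kap ?C u + kap ?C s"
        using kap_mult[OF C TU(1)[OF u] sU] stab by simp
      then have "\<theta> (kap ?C s) * \<theta> (- kap ?C (u * s)) = \<theta> (- kap ?C u)"
        by (simp add: theta_minus theta_diff)
      moreover have "u \<in> U" using u finT(2) by blast
      ultimately show "scale (\<theta> (kap ?C s)) (scale (\<theta> (- kap ?C (u * s))) (act v (u * s))) =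
          act (scale (\<theta> (- kap ?C u)) (act v u)) s"
        by (simp add: act_scale act_closed v s act_mult')
    qed
    also have "\<dots> = act (w B) s"
      unfolding w_def using W_subspace v(1) finT(2) s
      by (intro act_sum[symmetric] subspace_scale) (auto intro: act_closed)
    finally show "act (w B) s = scale (\<theta> (kap ?C s)) (w B)" ..
  qed
  then show ?thesis using C C_rows by blast
qed

text \<open>If rows \<open>i < a\<close> end in the same column, a multiple of row \<open>i\<close> is subtracted from row \<open>a\<close> to clear
  the last entry of the latter.  Each stabiliser equation of row \<open>a\<close> thereby changes by a multiple
  of one of row \<open>i\<close>, so the stabiliser stays the same.  The equation of row \<open>i\<close> for column \<open>a\<close>
  says exactly that the linear character does not change either.  The same vector \<open>v\<close> therefore serves the new matrix.\<close>
lemma leg_reduction: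
  assumes A: "A \<in> Vspace ty n" and v: "stab_eigenvector A v"
    and ij: "(i, j) \<in> main_pos ty n A" and aj: "(a, j) \<in> main_pos ty n A" and "i < a"
  obtains B where "B \<in> Vspace ty n" "stab_eigenvector B v"
    "\<And>r c. r \<in> {1..Ndim ty n} \<Longrightarrow> c \<in> {1..Ndim ty n} \<Longrightarrow> r \<noteq> a \<Longrightarrow> ent B r c = ent A r c"
    "\<And>c. j \<le> c \<Longrightarrow> c \<le> Ndim ty n \<Longrightarrow> ent B a c = 0"
proof -
  let ?N = "Ndim ty n"
  have P: "(i, j) \<in> Ppos ty n" "(a, j) \<in> Ppos ty n"
    and nz: "ent A i j \<noteq> 0"
    and right: "\<And>c. j < c \<Longrightarrow> c \<le> ?N \<Longrightarrow> ent A i c = 0" "\<And>c. j < c \<Longrightarrow> c \<le> ?N \<Longrightarrow> ent A a c = 0"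
    using ij aj by (auto simp: main_pos_def)
  note b = Ppos_bounds[OF P(1)] Ppos_bounds[OF P(2)]
  define t where "t = ent A a j / ent A i j"
  define B where "B = mat_of ?N (\<lambda>r c. if r = a \<and> a < c then ent A a c - t * ent A i c else ent A r c)"
  have Bc: "B \<in> carrier_mat ?N ?N" by (simp add: B_def)
  have Br: "ent B r c = ent A r c" if "r \<in> {1..?N}" "c \<in> {1..?N}" "r \<noteq> a" for r c
    using that by (simp add: B_def)
  have Ba: "ent B a c = ent A a c - t * ent A i c" if "a < c" "c \<le> ?N" for c
    using that b by (simp add: B_def)
  have Bl: "ent B a c = ent A a c" if "1 \<le> c" "c \<le> a" for c
    using that b by (simp add: B_def)
  have B0: "ent B a c = 0" if "j \<le> c" "c \<le> ?N" for c
    using that Ba[of c] right b nz by (cases "c = j") (auto simp: t_def)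
  have BV: "B \<in> Vspace ty n"
  proof (rule VspaceI[OF Bc])
    fix r c assume rc: "r \<in> {1..?N}" "c \<in> {1..?N}" and nz: "ent B r c \<noteq> 0"
    show "(r, c) \<in> Ppos ty n"
    proof (cases "r = a \<and> a < c")
      case True
      then have "c < j" using nz B0[of c] rc by force
      then show ?thesis using True Ppos_left[OF P(2)] by simp
    next
      case False
      then have "ent A r c \<noteq> 0" using nz Br[OF rc] Bl[of c] rc by (cases "r = a") auto
      then show ?thesis using Vspace_ent_0[OF A _ rc] by blast
    qed
  qed
  have "act v g = scale (\<theta> (kap B g)) v" if g: "g \<in> U" and stab: "tdot ty n B g = B" for g
  proof -
    note gU = Ugrp_Utilde[OF g]
    have row_i: "(\<Sum>l\<in>{k<..?N}. ent A i l * ent g k l) = 0" if k: "(i, k) \<in> Ppos ty n" for k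
    proof -
      have "(\<Sum>l\<in>{k<..?N}. ent A i l * ent g k l) = (\<Sum>l\<in>{k<..?N}. ent B i l * ent g k l)"
        using b \<open>i < a\<close> Ppos_bounds[OF k] by (intro sum.cong refl) (auto simp: Br)
      then show ?thesis using stab k unfolding tdot_eq_iff[OF BV gU] by auto
    qed
    have split: "(\<Sum>l\<in>{k<..?N}. ent A a l * ent g m l) =
        (\<Sum>l\<in>{k<..?N}. ent B a l * ent g m l) + t * (\<Sum>l\<in>{k<..?N}. ent A i l * ent g m l)" if "a \<le> k" for k m
    proof -
      have "(\<Sum>l\<in>{k<..?N}. ent A a l * ent g m l) = (\<Sum>l\<in>{k<..?N}. (ent B a l + t * ent A i l) * ent g m l)"
        using that by (intro sum.cong refl) (auto simp: Ba)
      then show ?thesis by (simp add: algebra_simps sum.distrib sum_distrib_left)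
    qed
    have "tdot ty n A g = A"
      unfolding tdot_eq_iff[OF A gU]
    proof clarify
      fix r k assume rk: "(r, k) \<in> Ppos ty n"
      note c = Ppos_bounds[OF rk]
      show "(\<Sum>l\<in>{k<..?N}. ent A r l * ent g k l) = 0"
      proof (cases "r = a")
        case True
        have "(i, k) \<in> Ppos ty n"
          using rk True \<open>i < a\<close> b by (auto simp: Ppos_def Pcirc_def Gam_def bar_def split: if_splits)
        moreover have "(\<Sum>l\<in>{k<..?N}. ent B a l * ent g k l) = 0"
          using stab rk True unfolding tdot_eq_iff[OF BV gU] by auto
        ultimately show ?thesis using True c split[of k k] row_i by simp
      next
        case False
        then have "(\<Sum>l\<in>{k<..?N}. ent A r l * ent g k l) = (\<Sum>l\<in>{k<..?N}. ent B r l * ent g k l)"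
          using c by (intro sum.cong refl) (auto simp: Br)
        then show ?thesis using stab rk unfolding tdot_eq_iff[OF BV gU] by auto
      qed
    qed
    then have "act v g = scale (\<theta> (kap A g)) v"
      using v g by (simp add: stab_eigenvector_def)
    moreover have "kap A g = kap B g"
      unfolding kap_ent[OF Vspace_carrier[OF A] Utilde_carrier_mat[OF gU]] kap_ent[OF Bc Utilde_carrier_mat[OF gU]]
    proof (rule sum.cong[OF refl])
      fix r assume r: "r \<in> {1..?N}"
      show "(\<Sum>l=1..?N. ent A r l * ent g r l) = (\<Sum>l=1..?N. ent B r l * ent g r l)"
      proof (cases "r = a")
        case True
        have ia: "(i, a) \<in> Ppos ty n" using Ppos_left[OF P(1), of a] \<open>i < a\<close> b by simp
        have cut: "(\<Sum>l=1..?N. ent X a l * ent g a l) = (\<Sum>l\<in>{a<..?N}. ent X a l * ent g a l)"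
          if X: "X \<in> Vspace ty n" for X
        proof (rule sum.mono_neutral_right)
          show "\<forall>l\<in>{1..?N} - {a<..?N}. ent X a l * ent g a l = 0"
          proof
            fix l assume l: "l \<in> {1..?N} - {a<..?N}"
            then have "(a, l) \<notin> Ppos ty n" using Ppos_bounds(2) by force
            then show "ent X a l * ent g a l = 0" using Vspace_ent_0[OF X] l b by simp
          qed
        qed auto
        show ?thesis using split[of a a] row_i[OF ia] True cut[OF A] cut[OF BV] by simp
      next
        case False
        then show ?thesis using r by (intro sum.cong refl) (auto simp: Br)
      qed
    qed
    ultimately show ?thesis by simp
  qed
  then have "stab_eigenvector B v" using v by (simp add: stab_eigenvector_def)
  then show thesis using that BV Br B0 by blast
qed

text \<open>Here row \<open>bar j\<close> is cleared completely, while the rows below it may change.  Let \<open>h\<close> stabilise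
  the rows above \<open>bar j\<close> and be trivial in the rows below.  Then the block of \<open>h\<close>
  between \<open>bar j\<close> and \<open>j\<close> is trivial, the equations of row \<open>i\<close> extend this to column \<open>j\<close>, and the
  form turns the vanishing of that part of column \<open>j\<close> into the vanishing of row \<open>bar j\<close> to the left
  of column \<open>j\<close>.  Since row \<open>bar j\<close> of \<open>A\<close> ends before column \<open>j\<close>, it contributes nothing to the
  equations for \<open>h\<close> or to the value \<open>kap A h\<close>, and it can be dropped before Fourier transform in the
  rows below.\<close>
lemma arm_reduction:
  assumes two: "(2::'a) \<noteq> 0"
    and A: "A \<in> Vspace ty n" and v: "stab_eigenvector A v"
    and ij: "(i, j) \<in> main_pos ty n A" and jb: "(bar ty n j, b) \<in> main_pos ty n A"
    and circ: "(bar ty n j, b) \<in> Pcirc ty n" and i: "i < bar ty n j"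
  obtains B w where "B \<in> Vspace ty n" "stab_eigenvector B w"
    "\<And>r c. r \<in> {1..Ndim ty n} \<Longrightarrow> c \<in> {1..Ndim ty n} \<Longrightarrow> r < bar ty n j \<Longrightarrow> ent B r c = ent A r c"
    "\<And>c. c \<in> {1..Ndim ty n} \<Longrightarrow> ent B (bar ty n j) c = 0"
proof -
  let ?N = "Ndim ty n" and ?k = "bar ty n j"
  have P: "(i, j) \<in> Ppos ty n" "(?k, b) \<in> Ppos ty n" and nz: "ent A i j \<noteq> 0"
    and right: "\<And>c. j < c \<Longrightarrow> c \<le> ?N \<Longrightarrow> ent A i c = 0" "\<And>c. b < c \<Longrightarrow> c \<le> ?N \<Longrightarrow> ent A ?k c = 0"
    using ij jb by (auto simp: main_pos_def)
  note bd = Ppos_bounds[OF P(1)] Ppos_bounds[OF P(2)]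
  have bbj: "bar ty n ?k = j" using bd by simp
  have bj: "?k < b" "b < j" using circ bbj by (auto simp: Pcirc_def)
  define A0 where "A0 = mat_of ?N (\<lambda>r c. if r < ?k then ent A r c else 0)"
  have A0c: "A0 \<in> carrier_mat ?N ?N" by (simp add: A0_def)
  have A0e: "ent A0 r c = (if r < ?k then ent A r c else 0)" if "r \<in> {1..?N}" "c \<in> {1..?N}" for r c
    using that by (simp add: A0_def)
  have A0: "A0 \<in> Vspace ty n"
    by (rule VspaceI[OF A0c]) (use Vspace_ent_0[OF A] A0e in \<open>force split: if_splits\<close>)
  have A0_rows: "ent A0 r c = 0" if "(r, c) \<in> Ppos ty n" "?k < r" for r c
    using A0e[of r c] Ppos_bounds[OF that(1)] that(2) by simp
  have H: "act v h = scale (\<theta> (kap A0 h)) v"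
    if h: "h \<in> U" and stab: "tdot ty n A0 h = A0"
      and zero: "\<And>r c. (r, c) \<in> Ppos ty n \<Longrightarrow> ?k < r \<Longrightarrow> ent h r c = 0" for h
  proof -
    note hU = Ugrp_isometry[OF two h]
    have block: "ent h r l = 0" if "?k < r" "r < l" "l < j" for r l
      by (rule isometry_block_trivial[OF two hU zero]) (use that bbj in auto)
    \<comment> \<open>In the equation of row \<open>i\<close> for column \<open>r\<close> only the term of column \<open>j\<close> survives.\<close>
    have colj: "ent h r j = 0" if r: "?k < r" "r < j" for r
    proof -
      have ir: "(i, r) \<in> Ppos ty n" using Ppos_left[OF P(1), of r] i r by simp
      have "(\<Sum>l\<in>{r<..?N}. ent A0 i l * ent h r l) = (\<Sum>l\<in>{r<..?N}. if l = j then ent A i j * ent h r j else 0)"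
      proof (intro sum.cong refl)
        fix l assume l: "l \<in> {r<..?N}"
        consider "l < j" | "l = j" | "j < l" by linarith
        then show "ent A0 i l * ent h r l = (if l = j then ent A i j * ent h r j else 0)"
          by cases (use l r block[of r l] right(1)[of l] i bd in \<open>auto simp: A0e\<close>)
      qed
      also have "\<dots> = ent A i j * ent h r j" using r bd by simp
      finally have "ent A i j * ent h r j = 0"
        using stab ir unfolding tdot_eq_iff[OF A0 hU(1)] by auto
      then show ?thesis using nz by simp
    qed
    have rowk: "ent h ?k l = 0" if "?k < l" "l < j" for l
    proof (rule isometry_row_trivial[OF hU])
      fix r m assume "?k < r" "r < m" "m \<le> j"
      then show "ent h r m = 0" using block[of r m] colj[of r] by (cases "m = j") auto
    qed (use that bd in auto)
    have A_zero: "ent A r l = 0" if "?k \<le> r" "r \<le> ?N" "j \<le> l" "l \<le> ?N" for r l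
    proof (cases "r = ?k")
      case True then show ?thesis using right(2)[of l] bj that by simp
    next
      case False
      then have "(r, l) \<notin> Ppos ty n"
        using that Ppos_bounds(3)[of r l ty n] bd by (auto simp: bar_def)
      then show ?thesis using Vspace_ent_0[OF A] that bd by simp
    qed
    have "tdot ty n A h = A"
      unfolding tdot_eq_iff[OF A hU(1)]
    proof clarify
      fix r c assume rc: "(r, c) \<in> Ppos ty n"
      note c = Ppos_bounds[OF rc]
      show "(\<Sum>l\<in>{c<..?N}. ent A r l * ent h c l) = 0"
      proof (cases "r < ?k")
        case True
        then have "(\<Sum>l\<in>{c<..?N}. ent A r l * ent h c l) = (\<Sum>l\<in>{c<..?N}. ent A0 r l * ent h c l)"
          using c by (intro sum.cong refl) (auto simp: A0e)
        then show ?thesis using stab rc unfolding tdot_eq_iff[OF A0 hU(1)] by auto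
      next
        case False
        have "ent A r l * ent h c l = 0" if "l \<in> {c<..?N}" for l
          using that False A_zero[of r l] block[of c l] c by (cases "l < j") auto
        then show ?thesis by (intro sum.neutral ballI) blast
      qed
    qed
    then have "act v h = scale (\<theta> (kap A h)) v"
      using v h by (simp add: stab_eigenvector_def)
    moreover have "kap A h = kap A0 h"
      unfolding kap_ent[OF Vspace_carrier[OF A] Utilde_carrier_mat[OF hU(1)]] kap_ent[OF A0c Utilde_carrier_mat[OF hU(1)]]
    proof (intro sum.cong refl)
      fix r l assume rl: "r \<in> {1..?N}" "l \<in> {1..?N}"
      show "ent A r l * ent h r l = ent A0 r l * ent h r l"
      proof (cases "r < ?k \<or> (r, l) \<notin> Ppos ty n")
        case True
        then show ?thesis using rl Vspace_ent_0[OF A _ rl] by (auto simp: A0e)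
      next
        case False
        then have "r < l" using Ppos_bounds(2) by blast
        then show ?thesis
          using False rl A_zero[of r l] rowk[of l] block[of r l]
          by (cases "l < j"; cases "r = ?k") (auto simp: A0e)
      qed
    qed
    ultimately show ?thesis by simp
  qed
  have vM: "v \<in> M" "v \<noteq> 0" using v by (auto simp: stab_eigenvector_def)
  have "\<exists>B w. B \<in> Vspace ty n \<and> stab_eigenvector B w \<and>
      (\<forall>r\<in>{1..?N}. \<forall>c\<in>{1..?N}. r \<le> ?k \<longrightarrow> ent B r c = ent A0 r c)"
    by (rule exists_stab_eigenvector[OF A0 _ vM]) (use A0_rows H in blast)+
  then obtain B w where B: "B \<in> Vspace ty n" "stab_eigenvector B w"
    "\<And>r c. r \<in> {1..?N} \<Longrightarrow> c \<in> {1..?N} \<Longrightarrow> r \<le> ?k \<Longrightarrow> ent B r c = ent A0 r c" by blast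
  show thesis
    by (rule that[OF B(1,2)]) (use B(3) A0e bd in auto)
qed

end

section \<open>Reaching a main separated matrix\<close>

text \<open>Every violation of main separation is caused by a pair of main positions.  It is recorded here
  at the lower one of the two rows, so that the condition for row \<open>a\<close> involves only rows up to \<open>a\<close>.\<close>
definition conflict_row :: "lie_type \<Rightarrow> nat \<Rightarrow> 'a::zero mat \<Rightarrow> nat \<Rightarrow> bool" where
  "conflict_row ty n A a \<longleftrightarrow> (\<exists>i j. i < a \<and> (i, j) \<in> main_pos ty n A \<and>
     ((a, j) \<in> main_pos ty n A \<or>
      a = bar ty n j \<and> (\<exists>b. (a, b) \<in> main_pos ty n A \<and> (a, b) \<in> Pcirc ty n)))"

lemma main_pos_cong:
  assumes "\<And>c. c \<in> {1..Ndim ty n} \<Longrightarrow> ent B r c = ent A r c"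
  shows "(r, c) \<in> main_pos ty n B \<longleftrightarrow> (r, c) \<in> main_pos ty n A"
proof (cases "(r, c) \<in> Ppos ty n")
  case True
  then show ?thesis using assms Ppos_bounds[OF True] by (auto simp: main_pos_def)
qed (simp add: main_pos_def)

lemma conflict_row_cong:
  assumes "\<And>r c. r \<in> {1..Ndim ty n} \<Longrightarrow> c \<in> {1..Ndim ty n} \<Longrightarrow> r \<le> a \<Longrightarrow> ent B r c = ent A r c"
  shows "conflict_row ty n B a \<longleftrightarrow> conflict_row ty n A a"
proof -
  have "(r, c) \<in> main_pos ty n B \<longleftrightarrow> (r, c) \<in> main_pos ty n A" if "r \<le> a" for r c
  proof (cases "r \<in> {1..Ndim ty n}")
    case True
    then show ?thesis using assms that by (intro main_pos_cong) auto
  next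
    case False
    then have "(r, c) \<notin> Ppos ty n" using Ppos_bounds(6) by blast
    then show ?thesis by (auto simp: main_pos_def)
  qed
  then have same: "(a, c) \<in> main_pos ty n B \<longleftrightarrow> (a, c) \<in> main_pos ty n A"
    "r < a \<Longrightarrow> (r, c) \<in> main_pos ty n B \<longleftrightarrow> (r, c) \<in> main_pos ty n A" for r c
    by simp_all
  show ?thesis unfolding conflict_row_def same(1) by (simp add: same(2) cong: conj_cong)
qed

text \<open>The limb of \<open>(i, j)\<close> lies in rows below \<open>i\<close>, except that in type C the arm of \<open>(i, bar i)\<close> lies in
  row \<open>i\<close> itself; but there it meets no main position, since row \<open>i\<close> has only one.\<close>
lemma main_separatedI:
  assumes no: "\<And>a. a \<in> {1..Ndim ty n} \<Longrightarrow> \<not> conflict_row ty n A a"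
  shows "main_separated ty n A"
  unfolding main_separated_def
proof (rule ccontr)
  assume "Limb ty n A \<inter> main_pos ty n A \<noteq> {}"
  then obtain a b where lim: "(a, b) \<in> Limb ty n A" and main: "(a, b) \<in> main_pos ty n A" by auto
  have aN: "a \<in> {1..Ndim ty n}" using main Ppos_bounds(6) by (auto simp: main_pos_def)
  have "conflict_row ty n A a"
  proof (cases "(a, b) \<in> Limb_circ ty n A")
    case True
    then obtain i j where ij: "(i, j) \<in> main_pos ty n A" "(a, b) \<in> arm ty n (i, j) \<or> (a, b) \<in> leg ty n (i, j)"
      by (auto simp: Limb_circ_def)
    from ij(2) show ?thesis
    proof
      assume "(a, b) \<in> leg ty n (i, j)"
      then show ?thesis using ij(1) main by (auto simp: leg_def conflict_row_def)
    next
      assume "(a, b) \<in> arm ty n (i, j)"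
      then have ab: "a = bar ty n j" "(a, b) \<in> Pcirc ty n" by (auto simp: arm_def)
      have P: "(i, j) \<in> Ppos ty n" using ij(1) by (auto simp: main_pos_def)
      have "b < j" using ab Ppos_bounds[OF P] by (auto simp: Pcirc_def)
      then have "i \<noteq> a" using main ij(1) Ppos_bounds[OF P] by (auto simp: main_pos_def)
      moreover have "i \<le> a" using ab(1) Ppos_bounds[OF P] by (auto simp: bar_def)
      ultimately have "i < a" by simp
      then show ?thesis
        unfolding conflict_row_def using ab main ij(1) by (intro exI[of _ i] exI[of _ j]) blast
    qed
  next
    case False
    then obtain i where "a = bar ty n b" "(i, b) \<in> main_pos ty n A" "(i, b) \<in> Pcirc ty n"
      using lim by (auto simp: Limb_def r_main_def split: if_splits)
    moreover from this have "i < a" by (auto simp: Pcirc_def bar_def)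
    ultimately show ?thesis using main by (auto simp: conflict_row_def)
  qed
  then show False using no aN by blast
qed

definition row_end :: "lie_type \<Rightarrow> nat \<Rightarrow> 'a::zero mat \<Rightarrow> nat \<Rightarrow> nat" where
  "row_end ty n A r = Max (insert 0 {c \<in> {1..Ndim ty n}. ent A r c \<noteq> 0})"

lemma row_end_less:
  assumes "ent A r j \<noteq> 0" "j \<in> {1..Ndim ty n}" "\<And>c. j \<le> c \<Longrightarrow> c \<le> Ndim ty n \<Longrightarrow> ent B r c = 0"
  shows "row_end ty n B r < row_end ty n A r"
proof -
  have "row_end ty n B r < j"
  proof -
    have "c < j" if "c \<in> insert 0 {c \<in> {1..Ndim ty n}. ent B r c \<noteq> 0}" for c
      using that assms(2) assms(3)[of c] by (cases "j \<le> c") auto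
    then show ?thesis unfolding row_end_def by (subst Max_less_iff) auto
  qed
  also have "j \<le> row_end ty n A r"
    unfolding row_end_def using assms by (intro Max_ge) auto
  finally show ?thesis .
qed

context U_module
begin

text \<open>The rows are treated from top to bottom.  In each row the matrix is chosen with row end as far to
  the left as possible; a conflict in that row could be reduced by one of the two moves, which
  leave the rows above alone.\<close>
lemma exists_separated_eigenvector:
  assumes two: "(2::'a) \<noteq> 0" and M: "M \<noteq> {0}"
  obtains A v where "A \<in> Vspace ty n" "main_separated ty n A" "stab_eigenvector A v"
proof -
  let ?N = "Ndim ty n"
  define good where "good k A \<longleftrightarrow> A \<in> Vspace ty n \<and> (\<exists>v. stab_eigenvector A v) \<and>
    (\<forall>a. 1 \<le> a \<and> a \<le> k \<longrightarrow> \<not> conflict_row ty n A a)" for k A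
  have "\<exists>A. good k A" if "k \<le> ?N" for k
    using that
  proof (induction k)
    case 0
    obtain v where v: "v \<in> M" "v \<noteq> 0" using M W_subspace subspace_0 by blast
    have Z: "(0\<^sub>m ?N ?N :: 'a mat) \<in> Vspace ty n" by (auto simp: ent_def intro!: VspaceI)
    have "\<exists>B w. B \<in> Vspace ty n \<and> stab_eigenvector B w \<and>
        (\<forall>i\<in>{1..?N}. \<forall>j\<in>{1..?N}. i \<le> 0 \<longrightarrow> ent B i j = ent (0\<^sub>m ?N ?N) i j)"
    proof (rule exists_stab_eigenvector[OF Z _ v, where k = 0])
      show "ent (0\<^sub>m ?N ?N) i j = 0" if "(i, j) \<in> Ppos ty n" for i j
        using Ppos_bounds[OF that] by (auto simp: ent_def)
      fix h assume h: "h \<in> U" and zero: "\<And>i j. (i, j) \<in> Ppos ty n \<Longrightarrow> 0 < i \<Longrightarrow> ent h i j = 0"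
      note hU = Ugrp_isometry[OF two h]
      \<comment> \<open>For \<open>k = 0\<close> the hypothesis of the Fourier step concerns the identity only.\<close>
      have "h = 1\<^sub>m ?N"
      proof (rule mat_eqI_ent[OF Utilde_carrier_mat[OF hU(1)]])
        fix i j assume ij: "i \<in> {1..?N}" "j \<in> {1..?N}"
        consider "j < i" | "j = i" | "i < j" by linarith
        then show "ent h i j = ent (1\<^sub>m ?N) i j"
        proof cases
          case 3
          have "ent h i j = 0"
            by (rule isometry_block_trivial[OF two hU zero, where k = 0]) (use 3 ij in \<open>auto simp: bar_def\<close>)
          then show ?thesis using 3 ij by (simp add: ent_one)
        qed (use ij Utilde_lower[OF hU(1)] Utilde_diag[OF hU(1)] in \<open>auto simp: ent_one\<close>)
      qed simp
      then show "act v h = scale (\<theta> (kap (0\<^sub>m ?N ?N) h)) v"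
        using act_one[OF v(1)] kap_one[OF Z] by simp
    qed
    then show ?case by (auto simp: good_def)
  next
    case (Suc k)
    then obtain A where A: "good k A" and least: "\<And>B. good k B \<Longrightarrow> row_end ty n A (Suc k) \<le> row_end ty n B (Suc k)"
      using ex_has_least_nat[of "good k" _ "\<lambda>A. row_end ty n A (Suc k)"] by auto
    from A obtain v where AV: "A \<in> Vspace ty n" and v: "stab_eigenvector A v" by (auto simp: good_def)
    have step: False if B: "B \<in> Vspace ty n" "stab_eigenvector B w"
        "\<And>r c. r \<in> {1..?N} \<Longrightarrow> c \<in> {1..?N} \<Longrightarrow> r < Suc k \<Longrightarrow> ent B r c = ent A r c"
        "row_end ty n B (Suc k) < row_end ty n A (Suc k)" for B w
    proof -
      have "conflict_row ty n B a \<longleftrightarrow> conflict_row ty n A a" if "a \<le> k" for a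
        using B(3) that by (intro conflict_row_cong) auto
      then have "good k B" using A B(1,2) by (auto simp: good_def)
      then show False using least[of B] B(4) by simp
    qed
    have "\<not> conflict_row ty n A (Suc k)"
    proof
      assume "conflict_row ty n A (Suc k)"
      then obtain i j where ij: "i < Suc k" "(i, j) \<in> main_pos ty n A"
        and or: "(Suc k, j) \<in> main_pos ty n A \<or>
          Suc k = bar ty n j \<and> (\<exists>b. (Suc k, b) \<in> main_pos ty n A \<and> (Suc k, b) \<in> Pcirc ty n)"
        by (auto simp: conflict_row_def)
      from or show False
      proof
        assume *: "(Suc k, j) \<in> main_pos ty n A"
        then have **: "ent A (Suc k) j \<noteq> 0" "j \<in> {1..?N}" using Ppos_bounds(7) by (auto simp: main_pos_def)
        obtain B where "B \<in> Vspace ty n" "stab_eigenvector B v"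
          "\<And>r c. r \<in> {1..?N} \<Longrightarrow> c \<in> {1..?N} \<Longrightarrow> r \<noteq> Suc k \<Longrightarrow> ent B r c = ent A r c"
          "\<And>c. j \<le> c \<Longrightarrow> c \<le> ?N \<Longrightarrow> ent B (Suc k) c = 0"
          using leg_reduction[OF AV v ij(2) * ij(1)] by metis
        then show False using step row_end_less[OF **] by (metis less_irrefl)
      next
        assume "Suc k = bar ty n j \<and> (\<exists>b. (Suc k, b) \<in> main_pos ty n A \<and> (Suc k, b) \<in> Pcirc ty n)"
        then obtain b where b: "Suc k = bar ty n j" "(Suc k, b) \<in> main_pos ty n A" "(Suc k, b) \<in> Pcirc ty n" by blast
        then have **: "ent A (Suc k) b \<noteq> 0" "b \<in> {1..?N}" using Ppos_bounds(7) by (auto simp: main_pos_def)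
        obtain B w where "B \<in> Vspace ty n" "stab_eigenvector B w"
          "\<And>r c. r \<in> {1..?N} \<Longrightarrow> c \<in> {1..?N} \<Longrightarrow> r < Suc k \<Longrightarrow> ent B r c = ent A r c"
          "\<And>c. c \<in> {1..?N} \<Longrightarrow> ent B (Suc k) c = 0"
          using arm_reduction[OF two AV v ij(2), of b] b ij(1) by metis
        moreover have "c \<in> {1..?N}" if "b \<le> c" "c \<le> ?N" for c using that **(2) by auto
        ultimately show False using step row_end_less[OF **] by metis
      qed
    qed
    then have "good (Suc k) A" using A by (auto simp: good_def le_Suc_eq)
    then show ?case by blast
  qed
  then obtain A where "good ?N A" by blast
  then show thesis using that main_separatedI[of ty n A] by (auto simp: good_def)
qed

end

text \<open>Summing \<open>x + 1\<close> over the field shows that its cardinality vanishes in it.\<close>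
lemma two_nonzero:
  assumes "odd (CARD('a))"
  shows "(2::'a::{field,finite}) \<noteq> 0"
proof
  assume two: "(2::'a) = 0"
  have "(\<Sum>x\<in>UNIV. x + 1 :: 'a) = (\<Sum>x\<in>UNIV. x)"
    by (rule sum.reindex_bij_betw[of "\<lambda>x. x + 1"]) (rule bij_plus_right)
  then have "of_nat (CARD('a)) = (0::'a)" by (simp add: sum.distrib)
  moreover obtain k where "CARD('a) = 2 * k + 1" using assms by (auto elim: oddE)
  ultimately show False using two by simp
qed

theorem theorem3p28:
  fixes \<theta> :: "'a::{field,finite} \<Rightarrow> complex"
    and p m n :: nat
    and ty :: lie_type
    and scaleM :: "complex \<Rightarrow> 'v::ab_group_add \<Rightarrow> 'v"
    and M :: "'v set"
    and actM :: "'v \<Rightarrow> 'a mat \<Rightarrow> 'v"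
  assumes "prime p" and "odd p" and "CARD('a) = p ^ m"
    and "n \<ge> 1"
    and "add_character \<theta>" and "\<exists>x. \<theta> x \<noteq> 1"
    and "cg_irreducible scaleM (Ugrp ty n :: 'a mat monoid) M actM"
  shows "\<exists>A \<in> Vspace ty n. main_separated ty n A \<and>
           cg_constituent (Ugrp ty n) scaleM M actM
             hat_scale (orbit_module ty n \<theta> A) (hat_act ty n \<theta>)"
proof -
  have two: "(2::'a) \<noteq> 0"
    by (rule two_nonzero) (use assms(2,3) in simp)
  have irr: "cg_module scaleM (Ugrp ty n :: 'a mat monoid) M actM" "M \<noteq> {0}"
    using assms(7) by (auto simp: cg_irreducible_def)
  interpret U_module \<theta> scaleM ty n M actM
    using assms(5,6) irr(1) by (intro U_module.intro additive_character.intro)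
  obtain A v where "A \<in> Vspace ty n" "main_separated ty n A" "stab_eigenvector A v"
    using exists_separated_eigenvector[OF two irr(2)] .
  then show ?thesis
    using stab_eigenvector_imp_constituent[OF assms(7)] by blast
qed

end
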